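(* Let $A\subseteq R\subseteq S$ be three Noetherian rings. Suppose that the inclusion $R\subseteq S$ has a splitting $\beta:S\to R$. Let $f\in R$. If the Bernstein-Sato polynomial $b^{S_A}_f(s)$ of $f$ in $S$ over $A$ exists, then the Bernstein-Sato polynomial $b^{R_A}_f(s)$ of $f$ in $R$ over $A$ also exists. Furthermore, $b^{R_A}_f(s)$ divides $b^{S_A}_f(s)$.
   Context: Rings are commutative. A splitting $\beta:S\to R$ is an $R$-linear map with $\beta|_R=\mathrm{id}_R$. Differential operators: for commutative rings $A\subseteq R$, $D_{R|A}=\bigcup_{m\geq 0}D^m_{R|A}\subseteq \mathrm{Hom}_A(R,R)$, where $D^0_{R|A}\cong R$ consists of multiplications by elements of $R$, and $\delta\in \mathrm{Hom}_A(R,R)$ lies in $D^m_{R|A}$ iff $[\delta,r]=\delta r-r\delta\in D^{m-1}_{R|A}$ for all $r\in R$. $R_f$ is a $D_{R|A}$-module by induction on order: $\delta\cdot\frac{v}{f^t}=\frac{\delta\cdot v}{f^t}$ for $\delta$ of order $0$, and in general $\delta\cdot \frac{v}{f^t}=\frac{\delta\cdot v-[\delta,f^t]\cdot\frac{v}{f^t}}{f^t}$. Bernstein-Sato polynomial: for Noetherian rings $A\subseteq R$ and $f\in R$, let $$\mathcal{B}=\{(\delta(s),b(s))\in D_{R|A}[s]\times A[s]\;:\;\delta(t)\cdot f^{t+1}=b(t)f^t \text{ in } R_f \text{ for all } t\in\mathbb{Z}\},$$ an $A[s]$-module, and let $\mathcal{B}_f\subseteq A[s]$ be the image of $\mathcal{B}$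 under projection to the second entry (an ideal of $A[s]$). If $\mathcal{B}_f=0$, one says that $f$ has no Bernstein-Sato polynomial. If $\mathcal{B}_f\neq 0$, the Bernstein-Sato polynomial is said to exist, and its monic generator is called the Bernstein-Sato polynomial of $f$, denoted $b^{R_A}_f(s)$. The definition presupposes that a nonzero $\mathcal{B}_f$ has a monic generator (automatic when $A$ is a field); the same definition with $S$ in place of $R$ gives $b^{S_A}_f(s)$. *)

theory Defs
  imports "HOL-Algebra.Algebra"
begin

text \<open>
  Throughout, \<open>R\<close> is a commutative ring and the subset \<open>A\<close> of \<open>carrier R\<close> is a subring,
  regarded as a ring in its own right as \<open>R\<lparr>carrier := A\<rparr>\<close>.
\<close>

definition is_splitting :: "('a, 'm) ring_scheme \<Rightarrow> 'a set \<Rightarrow> ('a \<Rightarrow> 'a) \<Rightarrow> bool"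
  where "is_splitting S R \<beta> \<longleftrightarrow>
    \<beta> \<in> carrier S \<rightarrow> R \<and>
    (\<forall>x\<in>carrier S. \<forall>y\<in>carrier S. \<beta> (x \<oplus>\<^bsub>S\<^esub> y) = \<beta> x \<oplus>\<^bsub>S\<^esub> \<beta> y) \<and>
    (\<forall>r\<in>R. \<forall>x\<in>carrier S. \<beta> (r \<otimes>\<^bsub>S\<^esub> x) = r \<otimes>\<^bsub>S\<^esub> \<beta> x) \<and>
    (\<forall>r\<in>R. \<beta> r = r)"


subsection \<open>Differential operators\<close>

text \<open>
  The ring \<open>Hom\<^sub>A(R, R)\<close>. Its elements are extensional functions, so that equality of operators
  is equality of functions on \<open>carrier R\<close>.
\<close>

definition lin_End :: "'a set \<Rightarrow> ('a, 'm) ring_scheme \<Rightarrow> ('a \<Rightarrow> 'a) ring"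
  where "lin_End A R =
    \<lparr>carrier = {\<delta> \<in> carrier R \<rightarrow>\<^sub>E carrier R.
        (\<forall>x\<in>carrier R. \<forall>y\<in>carrier R. \<delta> (x \<oplus>\<^bsub>R\<^esub> y) = \<delta> x \<oplus>\<^bsub>R\<^esub> \<delta> y) \<and>
        (\<forall>a\<in>A. \<forall>x\<in>carrier R. \<delta> (a \<otimes>\<^bsub>R\<^esub> x) = a \<otimes>\<^bsub>R\<^esub> \<delta> x)},
     monoid.mult = compose (carrier R),
     one = (\<lambda>x\<in>carrier R. x),
     ring.zero = (\<lambda>x\<in>carrier R. \<zero>\<^bsub>R\<^esub>),
     ring.add = (\<lambda>\<delta> \<epsilon>. \<lambda>x\<in>carrier R. \<delta> x \<oplus>\<^bsub>R\<^esub> \<epsilon> x)\<rparr>"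

definition mult_op :: "('a, 'm) ring_scheme \<Rightarrow> 'a \<Rightarrow> 'a \<Rightarrow> 'a"
  where "mult_op R r = (\<lambda>x\<in>carrier R. r \<otimes>\<^bsub>R\<^esub> x)"

definition op_bracket :: "'a set \<Rightarrow> ('a, 'm) ring_scheme \<Rightarrow> ('a \<Rightarrow> 'a) \<Rightarrow> 'a \<Rightarrow> 'a \<Rightarrow> 'a"
  where "op_bracket A R \<delta> r =
    \<delta> \<otimes>\<^bsub>lin_End A R\<^esub> mult_op R r \<ominus>\<^bsub>lin_End A R\<^esub> mult_op R r \<otimes>\<^bsub>lin_End A R\<^esub> \<delta>"

primrec diff_ops_le :: "'a set \<Rightarrow> ('a, 'm) ring_scheme \<Rightarrow> nat \<Rightarrow> ('a \<Rightarrow> 'a) set"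
  where
    "diff_ops_le A R 0 = mult_op R ` carrier R"
  | "diff_ops_le A R (Suc m) =
      {\<delta> \<in> carrier (lin_End A R). \<forall>r\<in>carrier R. op_bracket A R \<delta> r \<in> diff_ops_le A R m}"

definition diff_op_ring :: "'a set \<Rightarrow> ('a, 'm) ring_scheme \<Rightarrow> ('a \<Rightarrow> 'a) ring"
  where "diff_op_ring A R = (lin_End A R)\<lparr>carrier := (\<Union>m. diff_ops_le A R m)\<rparr>"

definition diff_op_order :: "'a set \<Rightarrow> ('a, 'm) ring_scheme \<Rightarrow> ('a \<Rightarrow> 'a) \<Rightarrow> nat"
  where "diff_op_order A R \<delta> = (LEAST m. \<delta> \<in> diff_ops_le A R m)"


subsection \<open>The localization at powers of an element\<close>

text \<open>
  The pair \<open>(v, t)\<close> represents the fraction \<open>v / f\<^sup>t\<close>. No assumption is made on \<open>f\<close>, which may be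
  a zero divisor or nilpotent.
\<close>

definition loc_rel :: "('a, 'm) ring_scheme \<Rightarrow> 'a \<Rightarrow> (('a \<times> nat) \<times> ('a \<times> nat)) set"
  where "loc_rel R f =
    {((v, t), (w, u)). v \<in> carrier R \<and> w \<in> carrier R \<and>
       (\<exists>k::nat. f [^]\<^bsub>R\<^esub> k \<otimes>\<^bsub>R\<^esub> (f [^]\<^bsub>R\<^esub> u \<otimes>\<^bsub>R\<^esub> v) = f [^]\<^bsub>R\<^esub> k \<otimes>\<^bsub>R\<^esub> (f [^]\<^bsub>R\<^esub> t \<otimes>\<^bsub>R\<^esub> w))}"

definition loc_frac :: "('a, 'm) ring_scheme \<Rightarrow> 'a \<Rightarrow> 'a \<Rightarrow> nat \<Rightarrow> ('a \<times> nat) set"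
  where "loc_frac R f v t = loc_rel R f `` {(v, t)}"

definition loc_ring :: "('a, 'm) ring_scheme \<Rightarrow> 'a \<Rightarrow> ('a \<times> nat) set ring"
  where "loc_ring R f =
    \<lparr>carrier = (carrier R \<times> UNIV) // loc_rel R f,
     monoid.mult = (\<lambda>P Q. \<Union>(v, t)\<in>P. \<Union>(w, u)\<in>Q. loc_frac R f (v \<otimes>\<^bsub>R\<^esub> w) (t + u)),
     one = loc_frac R f \<one>\<^bsub>R\<^esub> 0,
     ring.zero = loc_frac R f \<zero>\<^bsub>R\<^esub> 0,
     ring.add = (\<lambda>P Q. \<Union>(v, t)\<in>P. \<Union>(w, u)\<in>Q.
              loc_frac R f (f [^]\<^bsub>R\<^esub> u \<otimes>\<^bsub>R\<^esub> v \<oplus>\<^bsub>R\<^esub> f [^]\<^bsub>R\<^esub> t \<otimes>\<^bsub>R\<^esub> w) (t + u))\<rparr>"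

text \<open>
  The action of \<open>\<delta>\<close>, an operator of order at most the natural number argument, on the fraction
  \<open>v / f\<^sup>t\<close>, by recursion on that bound.
\<close>

primrec loc_act_frac ::
  "'a set \<Rightarrow> ('a, 'm) ring_scheme \<Rightarrow> 'a \<Rightarrow> nat \<Rightarrow> ('a \<Rightarrow> 'a) \<Rightarrow> 'a \<Rightarrow> nat \<Rightarrow> ('a \<times> nat) set"
  where
    "loc_act_frac A R f 0 \<delta> v t = loc_frac R f (\<delta> v) t"
  | "loc_act_frac A R f (Suc m) \<delta> v t =
      loc_frac R f \<one>\<^bsub>R\<^esub> t \<otimes>\<^bsub>loc_ring R f\<^esub>
        (loc_frac R f (\<delta> v) 0 \<ominus>\<^bsub>loc_ring R f\<^esub>
         loc_act_frac A R f m (op_bracket A R \<delta> (f [^]\<^bsub>R\<^esub> t)) v t)"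

text \<open>
  The result of the recursion does not depend on the representative of the fraction, so the
  union below is over copies of a single equivalence class.
\<close>

definition loc_act ::
  "'a set \<Rightarrow> ('a, 'm) ring_scheme \<Rightarrow> 'a \<Rightarrow> ('a \<Rightarrow> 'a) \<Rightarrow> ('a \<times> nat) set \<Rightarrow> ('a \<times> nat) set"
  where "loc_act A R f \<delta> P =
    (\<Union>(v, t)\<in>P. loc_act_frac A R f (diff_op_order A R \<delta>) \<delta> v t)"


subsection \<open>Bernstein-Sato polynomials\<close>

definition eval_at_int :: "('a, 'm) ring_scheme \<Rightarrow> int \<Rightarrow> (nat \<Rightarrow> 'a) \<Rightarrow> 'a"
  where "eval_at_int K t p = eval K K (\<lambda>x. x) ([t] \<cdot>\<^bsub>K\<^esub> \<one>\<^bsub>K\<^esub>) p"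

definition bs_pairs ::
  "'a set \<Rightarrow> ('a, 'm) ring_scheme \<Rightarrow> 'a \<Rightarrow> ((nat \<Rightarrow> 'a \<Rightarrow> 'a) \<times> (nat \<Rightarrow> 'a)) set"
  where "bs_pairs A R f =
    {(\<delta>, b). \<delta> \<in> carrier (UP (diff_op_ring A R)) \<and> b \<in> carrier (UP (R\<lparr>carrier := A\<rparr>)) \<and>
      (\<forall>t::int.
        loc_act A R f (eval_at_int (diff_op_ring A R) t \<delta>)
          (loc_frac R f f 0 [^]\<^bsub>loc_ring R f\<^esub> (t + 1)) =
        loc_frac R f (eval_at_int (R\<lparr>carrier := A\<rparr>) t b) 0 \<otimes>\<^bsub>loc_ring R f\<^esub>
          (loc_frac R f f 0 [^]\<^bsub>loc_ring R f\<^esub> t))}"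

definition bs_ideal :: "'a set \<Rightarrow> ('a, 'm) ring_scheme \<Rightarrow> 'a \<Rightarrow> (nat \<Rightarrow> 'a) set"
  where "bs_ideal A R f = snd ` bs_pairs A R f"

definition bs_poly_exists :: "'a set \<Rightarrow> ('a, 'm) ring_scheme \<Rightarrow> 'a \<Rightarrow> bool"
  where "bs_poly_exists A R f \<longleftrightarrow> bs_ideal A R f \<noteq> {\<zero>\<^bsub>UP (R\<lparr>carrier := A\<rparr>)\<^esub>}"

text \<open>
  A monic generator is unique when there is one, so this predicate has at most one solution \<open>b\<close>.
  Over a ring \<open>A\<close> that is not a field a nonzero ideal need not have a monic generator.
\<close>

definition is_bs_poly :: "'a set \<Rightarrow> ('a, 'm) ring_scheme \<Rightarrow> 'a \<Rightarrow> (nat \<Rightarrow> 'a) \<Rightarrow> bool"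
  where "is_bs_poly A R f b \<longleftrightarrow>
    bs_poly_exists A R f \<and>
    b \<in> carrier (UP (R\<lparr>carrier := A\<rparr>)) \<and>
    coeff (UP (R\<lparr>carrier := A\<rparr>)) b (deg (R\<lparr>carrier := A\<rparr>) b) = \<one>\<^bsub>R\<^esub> \<and>
    bs_ideal A R f = PIdl\<^bsub>UP (R\<lparr>carrier := A\<rparr>)\<^esub> b"

end

theory Submission
  imports Defs
begin

text \<open>
  Composing an operator on \<open>S\<close> with the splitting \<open>\<beta>\<close> and restricting it to \<open>R\<close> gives an operator
  on \<open>R\<close>, written \<open>push \<delta>\<close>. Because \<open>\<beta>\<close> is \<open>R\<close>-linear, this assignment commutes with the brackets
  \<open>[\<delta>, r]\<close> for \<open>r \<in> R\<close>, hence does not raise the order (lemma \<open>push_diff_ops_lt\<close>). Applied to the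
  coefficients of \<open>\<delta>(s)\<close>, it turns a pair \<open>(\<delta>(s), b(s))\<close> for \<open>S\<close> into a pair for \<open>R\<close> with the same
  \<open>b(s)\<close> (lemma \<open>push_bs_pair\<close>): morally one applies \<open>\<beta>\<close> to the equation
  \<open>\<delta>(t) f\<^sup>t\<^sup>+\<^sup>1 = b(t) f\<^sup>t\<close> and uses that \<open>b(t)\<close> and the powers of \<open>f\<close> lie in \<open>R\<close>. So the ideal
  \<open>B\<^sub>f\<close> of \<open>S\<close> is contained in that of \<open>R\<close>. If the first is nonzero then so is the second, and a
  generator of the second divides a generator of the first.

  The work lies in the negative exponents \<open>t\<close>, where the equation lives in the localization and
  involves the inductively defined action on fractions. This action has a closed form: for \<open>\<delta>\<close> of
  order less than \<open>m\<close>, the fraction \<open>\<delta> \<cdot> (v / g)\<close> is \<open>act_num m \<delta> v g / g\<^sup>m\<close>, where the numerator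
  is built from values of \<open>\<delta>\<close> inside the ring. Its behaviour under expanding the fraction and under
  enlarging the bound \<open>m\<close> (lemmas \<open>act_num_expand_fraction\<close> and \<open>act_num_order_mono\<close>) shows that
  neither the representative of the fraction nor the bound on the order matters, which is lemma
  \<open>loc_act_eq\<close>. The second point is needed because \<open>push \<delta>\<close> may have smaller order than \<open>\<delta>\<close>. In this
  form the defining equation is an identity in the ring up to a power of \<open>f\<close> (lemma
  \<open>bs_equation_iff\<close>), and \<open>\<beta>\<close> maps the numerator of \<open>\<delta>\<close> to that of \<open>push \<delta>\<close> (lemma
  \<open>push_act_num\<close>).
\<close>

section \<open>The ring of differential operators\<close>

locale cring_with_scalars = cring R for R (structure) +
  fixes A :: "'a set"
  assumes scalars_subset: "A \<subseteq> carrier R"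
begin

abbreviation E where "E \<equiv> lin_End A R"

lemma scalar_closed [simp]: "a \<in> A \<Longrightarrow> a \<in> carrier R"
  using scalars_subset by blast

lemma lin_End_carrier_iff:
  "\<delta> \<in> carrier E \<longleftrightarrow> \<delta> \<in> carrier R \<rightarrow>\<^sub>E carrier R \<and>
     (\<forall>x\<in>carrier R. \<forall>y\<in>carrier R. \<delta> (x \<oplus> y) = \<delta> x \<oplus> \<delta> y) \<and>
     (\<forall>a\<in>A. \<forall>x\<in>carrier R. \<delta> (a \<otimes> x) = a \<otimes> \<delta> x)"
  by (simp add: lin_End_def)

lemma lin_End_closed [simp]: "\<delta> \<in> carrier E \<Longrightarrow> x \<in> carrier R \<Longrightarrow> \<delta> x \<in> carrier R"
  by (auto simp: lin_End_carrier_iff)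

lemma lin_End_add: "\<delta> \<in> carrier E \<Longrightarrow> x \<in> carrier R \<Longrightarrow> y \<in> carrier R \<Longrightarrow> \<delta> (x \<oplus> y) = \<delta> x \<oplus> \<delta> y"
  by (auto simp: lin_End_carrier_iff)

lemma lin_End_scalar: "\<delta> \<in> carrier E \<Longrightarrow> a \<in> A \<Longrightarrow> x \<in> carrier R \<Longrightarrow> \<delta> (a \<otimes> x) = a \<otimes> \<delta> x"
  by (auto simp: lin_End_carrier_iff)

lemma lin_End_eqI:
  assumes "\<delta> \<in> carrier E" "\<epsilon> \<in> carrier E" "\<And>x. x \<in> carrier R \<Longrightarrow> \<delta> x = \<epsilon> x"
  shows "\<delta> = \<epsilon>"
  using assms by (auto simp: lin_End_carrier_iff intro!: PiE_ext[of \<delta> "carrier R" "\<lambda>_. carrier R"])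

lemma lin_End_add_closed:
  assumes "\<delta> \<in> carrier E" "\<epsilon> \<in> carrier E"
  shows "\<delta> \<oplus>\<^bsub>E\<^esub> \<epsilon> \<in> carrier E"
proof -
  have "\<delta> \<oplus>\<^bsub>E\<^esub> \<epsilon> = (\<lambda>x\<in>carrier R. \<delta> x \<oplus> \<epsilon> x)"
    by (simp add: lin_End_def)
  then show ?thesis
    unfolding lin_End_carrier_iff using assms
    by (auto simp: lin_End_add lin_End_scalar a_ac r_distr)
qed

lemma lin_End_add_apply: "x \<in> carrier R \<Longrightarrow> (\<delta> \<oplus>\<^bsub>E\<^esub> \<epsilon>) x = \<delta> x \<oplus> \<epsilon> x"
  by (simp add: lin_End_def)

lemma lin_End_zero_apply: "x \<in> carrier R \<Longrightarrow> \<zero>\<^bsub>E\<^esub> x = \<zero>"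
  by (simp add: lin_End_def)

lemma lin_End_zero_closed: "\<zero>\<^bsub>E\<^esub> \<in> carrier E"
  unfolding lin_End_carrier_iff by (auto simp: lin_End_def)

lemma lin_End_mult_apply: "x \<in> carrier R \<Longrightarrow> (\<delta> \<otimes>\<^bsub>E\<^esub> \<epsilon>) x = \<delta> (\<epsilon> x)"
  by (simp add: lin_End_def compose_def)

lemma lin_End_mult_closed:
  assumes "\<delta> \<in> carrier E" "\<epsilon> \<in> carrier E"
  shows "\<delta> \<otimes>\<^bsub>E\<^esub> \<epsilon> \<in> carrier E"
proof -
  have "\<delta> \<otimes>\<^bsub>E\<^esub> \<epsilon> = (\<lambda>x\<in>carrier R. \<delta> (\<epsilon> x))"
    by (simp add: lin_End_def compose_def)
  then show ?thesis
    unfolding lin_End_carrier_iff using assms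
    by (auto simp: lin_End_add lin_End_scalar)
qed

lemma lin_End_one_apply: "x \<in> carrier R \<Longrightarrow> \<one>\<^bsub>E\<^esub> x = x"
  by (simp add: lin_End_def)

lemma lin_End_one_closed: "\<one>\<^bsub>E\<^esub> \<in> carrier E"
  unfolding lin_End_carrier_iff by (auto simp: lin_End_def)

lemmas lin_End_apply = lin_End_add_apply lin_End_zero_apply lin_End_mult_apply lin_End_one_apply
lemmas lin_End_op_closed =
  lin_End_add_closed lin_End_zero_closed lin_End_mult_closed lin_End_one_closed

text \<open>
  Additive inverses in \<open>Hom\<^sub>A(R, R)\<close> are characterized only through the ring structure; this shows
  that they are pointwise.
\<close>

lemma lin_End_neg:
  assumes "\<delta> \<in> carrier E"
  shows "(\<lambda>x\<in>carrier R. \<ominus> \<delta> x) \<in> carrier E" "(\<lambda>x\<in>carrier R. \<ominus> \<delta> x) \<oplus>\<^bsub>E\<^esub> \<delta> = \<zero>\<^bsub>E\<^esub>"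
proof -
  show *: "(\<lambda>x\<in>carrier R. \<ominus> \<delta> x) \<in> carrier E"
    unfolding lin_End_carrier_iff using assms
    by (auto simp: lin_End_add lin_End_scalar minus_add r_minus)
  show "(\<lambda>x\<in>carrier R. \<ominus> \<delta> x) \<oplus>\<^bsub>E\<^esub> \<delta> = \<zero>\<^bsub>E\<^esub>"
    by (rule lin_End_eqI) (use assms * in \<open>auto simp: lin_End_apply lin_End_op_closed l_neg\<close>)
qed

lemma lin_End_ring: "ring E"
proof (rule ringI)
  show "abelian_group E"
  proof (rule abelian_groupI)
    fix \<delta> assume "\<delta> \<in> carrier E"
    then show "\<exists>\<epsilon>\<in>carrier E. \<epsilon> \<oplus>\<^bsub>E\<^esub> \<delta> = \<zero>\<^bsub>E\<^esub>"
      using lin_End_neg by blast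
  qed (auto intro!: lin_End_eqI simp: lin_End_apply lin_End_op_closed a_ac)
  show "monoid E"
    by (rule monoidI) (auto intro!: lin_End_eqI simp: lin_End_apply lin_End_op_closed)
qed (auto intro!: lin_End_eqI simp: lin_End_apply lin_End_op_closed lin_End_add)

sublocale E: ring "lin_End A R"
  by (rule lin_End_ring)

lemma lin_End_minus_apply:
  assumes "\<delta> \<in> carrier E" "\<epsilon> \<in> carrier E" "x \<in> carrier R"
  shows "(\<delta> \<ominus>\<^bsub>E\<^esub> \<epsilon>) x = \<delta> x \<ominus> \<epsilon> x"
proof -
  have "\<ominus>\<^bsub>E\<^esub> \<epsilon> = (\<lambda>x\<in>carrier R. \<ominus> \<epsilon> x)"
    using lin_End_neg[OF assms(2)] assms by (intro E.minus_equality) auto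
  then show ?thesis
    using assms by (simp add: a_minus_def lin_End_add_apply)
qed

lemma mult_op_closed [simp]: "r \<in> carrier R \<Longrightarrow> mult_op R r \<in> carrier E"
  unfolding lin_End_carrier_iff by (auto simp: mult_op_def r_distr m_lcomm)

lemma mult_op_apply: "x \<in> carrier R \<Longrightarrow> mult_op R r x = r \<otimes> x"
  by (simp add: mult_op_def)

lemma op_bracket_closed [simp]:
  "\<delta> \<in> carrier E \<Longrightarrow> r \<in> carrier R \<Longrightarrow> op_bracket A R \<delta> r \<in> carrier E"
  by (simp add: op_bracket_def)

lemma op_bracket_apply:
  assumes "\<delta> \<in> carrier E" "r \<in> carrier R" "x \<in> carrier R"
  shows "op_bracket A R \<delta> r x = \<delta> (r \<otimes> x) \<ominus> r \<otimes> \<delta> x"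
  using assms by (simp add: op_bracket_def lin_End_minus_apply lin_End_mult_apply mult_op_apply)

text \<open>
  Shifting the order by one puts the zero operator, as the only operator of negative order, at
  the start of the filtration. Order \<open>0\<close> then needs no separate treatment in inductions.
\<close>

primrec diff_ops_lt :: "nat \<Rightarrow> ('a \<Rightarrow> 'a) set"
  where
    "diff_ops_lt 0 = {\<zero>\<^bsub>E\<^esub>}"
  | "diff_ops_lt (Suc m) =
      {\<delta> \<in> carrier E. \<forall>r\<in>carrier R. op_bracket A R \<delta> r \<in> diff_ops_lt m}"

text \<open>
  An operator \<open>\<delta>\<close> that commutes with all multiplications is multiplication by \<open>\<delta> 1\<close>.
\<close>

lemma diff_ops_le_eq_lt: "diff_ops_le A R m = diff_ops_lt (Suc m)"
proof (induction m)
  case 0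
  have "\<delta> \<in> mult_op R ` carrier R \<longleftrightarrow> \<delta> \<in> diff_ops_lt (Suc 0)" for \<delta>
  proof
    assume "\<delta> \<in> mult_op R ` carrier R"
    then obtain r where r: "r \<in> carrier R" "\<delta> = mult_op R r" by blast
    have "op_bracket A R \<delta> s = \<zero>\<^bsub>E\<^esub>" if "s \<in> carrier R" for s
      by (rule lin_End_eqI)
        (use r that in \<open>auto simp: op_bracket_apply mult_op_apply lin_End_zero_apply m_lcomm a_minus_def r_neg\<close>)
    with r show "\<delta> \<in> diff_ops_lt (Suc 0)" by simp
  next
    assume \<delta>: "\<delta> \<in> diff_ops_lt (Suc 0)"
    have "\<delta> = mult_op R (\<delta> \<one>)"
    proof (rule lin_End_eqI)
      fix x assume x: "x \<in> carrier R"
      have "op_bracket A R \<delta> x \<one> = \<zero>" using \<delta> x by (simp add: lin_End_zero_apply)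
      then have "\<delta> x \<ominus> x \<otimes> \<delta> \<one> = \<zero>"
        using \<delta> x op_bracket_apply[of \<delta> x \<one>] by simp
      then have "\<delta> x = x \<otimes> \<delta> \<one>"
        using \<delta> x by simp
      then show "\<delta> x = mult_op R (\<delta> \<one>) x"
        using \<delta> x by (simp add: mult_op_apply m_comm[of x])
    qed (use \<delta> in auto)
    then show "\<delta> \<in> mult_op R ` carrier R" using \<delta> by auto
  qed
  then show ?case by auto
next
  case (Suc m)
  then show ?case by simp
qed

lemma diff_ops_lt_subset: "diff_ops_lt m \<subseteq> carrier E"
  by (cases m) (auto simp: lin_End_zero_closed)

lemma op_bracket_zero: "r \<in> carrier R \<Longrightarrow> op_bracket A R \<zero>\<^bsub>E\<^esub> r = \<zero>\<^bsub>E\<^esub>"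
  by (rule lin_End_eqI) (auto simp: op_bracket_apply lin_End_zero_apply a_minus_def)

lemma zero_in_diff_ops_lt: "\<zero>\<^bsub>E\<^esub> \<in> diff_ops_lt m"
  by (induction m) (auto simp: op_bracket_zero)

lemma diff_ops_lt_Suc: "diff_ops_lt m \<subseteq> diff_ops_lt (Suc m)"
  by (induction m) (auto simp: op_bracket_zero)

lemma diff_ops_lt_mono: "m \<le> n \<Longrightarrow> diff_ops_lt m \<subseteq> diff_ops_lt n"
  using lift_Suc_mono_le[of diff_ops_lt] diff_ops_lt_Suc by blast

lemma op_bracket_add:
  assumes "\<delta> \<in> carrier E" "\<epsilon> \<in> carrier E" "r \<in> carrier R"
  shows "op_bracket A R (\<delta> \<oplus>\<^bsub>E\<^esub> \<epsilon>) r = op_bracket A R \<delta> r \<oplus>\<^bsub>E\<^esub> op_bracket A R \<epsilon> r"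
  by (rule lin_End_eqI)
    (use assms in \<open>auto simp: op_bracket_apply lin_End_apply a_minus_def r_distr minus_add a_ac\<close>)

lemma op_bracket_uminus:
  assumes "\<delta> \<in> carrier E" "r \<in> carrier R"
  shows "op_bracket A R (\<ominus>\<^bsub>E\<^esub> \<delta>) r = \<ominus>\<^bsub>E\<^esub> op_bracket A R \<delta> r"
proof -
  have "op_bracket A R (\<ominus>\<^bsub>E\<^esub> \<delta>) r \<oplus>\<^bsub>E\<^esub> op_bracket A R \<delta> r = \<zero>\<^bsub>E\<^esub>"
    using assms by (simp add: op_bracket_add[symmetric] E.l_neg op_bracket_zero)
  then show ?thesis
    using assms by (metis E.add.inv_equality E.add.inv_closed op_bracket_closed)
qed

lemma op_bracket_mult:
  assumes "\<delta> \<in> carrier E" "\<epsilon> \<in> carrier E" "r \<in> carrier R"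
  shows "op_bracket A R (\<delta> \<otimes>\<^bsub>E\<^esub> \<epsilon>) r =
    \<delta> \<otimes>\<^bsub>E\<^esub> op_bracket A R \<epsilon> r \<oplus>\<^bsub>E\<^esub> op_bracket A R \<delta> r \<otimes>\<^bsub>E\<^esub> \<epsilon>"
proof (rule lin_End_eqI)
  fix x assume x: "x \<in> carrier R"
  have "\<delta> (\<epsilon> (r \<otimes> x)) = \<delta> (\<epsilon> (r \<otimes> x) \<ominus> r \<otimes> \<epsilon> x) \<oplus> \<delta> (r \<otimes> \<epsilon> x)"
    using assms x by (simp add: lin_End_add[symmetric] a_minus_def a_assoc l_neg)
  then show "op_bracket A R (\<delta> \<otimes>\<^bsub>E\<^esub> \<epsilon>) r x =
      (\<delta> \<otimes>\<^bsub>E\<^esub> op_bracket A R \<epsilon> r \<oplus>\<^bsub>E\<^esub> op_bracket A R \<delta> r \<otimes>\<^bsub>E\<^esub> \<epsilon>) x"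
    using assms x by (simp add: op_bracket_apply lin_End_apply a_minus_def a_assoc)
qed (use assms in \<open>auto simp: lin_End_op_closed\<close>)

lemma diff_ops_lt_add:
  "\<delta> \<in> diff_ops_lt m \<Longrightarrow> \<epsilon> \<in> diff_ops_lt m \<Longrightarrow> \<delta> \<oplus>\<^bsub>E\<^esub> \<epsilon> \<in> diff_ops_lt m"
  by (induction m arbitrary: \<delta> \<epsilon>) (auto simp: op_bracket_add)

lemma diff_ops_lt_uminus: "\<delta> \<in> diff_ops_lt m \<Longrightarrow> \<ominus>\<^bsub>E\<^esub> \<delta> \<in> diff_ops_lt m"
  by (induction m arbitrary: \<delta>) (auto simp: op_bracket_uminus)

text \<open>
  The Leibniz rule for brackets lowers the order of one factor at a time. For
  positive \<open>m\<close> and \<open>n\<close> the product even has order less than \<open>m + n - 1\<close>; the weaker bound avoids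
  truncated subtraction and suffices to show that products have finite order.
\<close>

lemma diff_ops_lt_mult:
  "\<delta> \<in> diff_ops_lt m \<Longrightarrow> \<epsilon> \<in> diff_ops_lt n \<Longrightarrow> \<delta> \<otimes>\<^bsub>E\<^esub> \<epsilon> \<in> diff_ops_lt (m + n)"
proof (induction "m + n" arbitrary: m n \<delta> \<epsilon>)
  case 0
  then show ?case by simp
next
  case (Suc k)
  have clos: "\<delta> \<in> carrier E" "\<epsilon> \<in> carrier E"
    using Suc.prems diff_ops_lt_subset by blast+
  show ?case
  proof (cases "m = 0 \<or> n = 0")
    case True
    then have "\<delta> \<otimes>\<^bsub>E\<^esub> \<epsilon> = \<zero>\<^bsub>E\<^esub>" using Suc.prems clos by auto
    then show ?thesis by (simp only: zero_in_diff_ops_lt)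
  next
    case False
    then obtain m' n' where mn: "m = Suc m'" "n = Suc n'" by (auto simp: gr0_conv_Suc)
    have "op_bracket A R (\<delta> \<otimes>\<^bsub>E\<^esub> \<epsilon>) r \<in> diff_ops_lt k" if r: "r \<in> carrier R" for r
    proof -
      have "\<delta> \<otimes>\<^bsub>E\<^esub> op_bracket A R \<epsilon> r \<in> diff_ops_lt (m + n')"
        using Suc mn r by (intro Suc.hyps(1)) auto
      moreover have "op_bracket A R \<delta> r \<otimes>\<^bsub>E\<^esub> \<epsilon> \<in> diff_ops_lt (m' + n)"
        using Suc mn r by (intro Suc.hyps(1)) auto
      moreover have "m + n' = k" "m' + n = k" using Suc.hyps mn by auto
      ultimately show ?thesis
        using r clos by (simp add: op_bracket_mult diff_ops_lt_add)
    qed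
    moreover have "m + n = Suc k" using Suc.hyps by simp
    ultimately show ?thesis using clos by simp
  qed
qed

abbreviation D where "D \<equiv> diff_op_ring A R"

lemma diff_op_carrier: "carrier D = (\<Union>m. diff_ops_lt m)"
proof -
  have "diff_ops_lt m \<subseteq> diff_ops_lt (Suc m)" for m by (rule diff_ops_lt_Suc)
  then show ?thesis
    unfolding diff_op_ring_def by (auto simp del: diff_ops_lt.simps simp: diff_ops_le_eq_lt)
qed

lemma diff_op_in_lin_End [simp]: "\<delta> \<in> carrier D \<Longrightarrow> \<delta> \<in> carrier E"
  using diff_ops_lt_subset by (auto simp: diff_op_carrier)

lemma mult_op_in_diff_ops_lt: "r \<in> carrier R \<Longrightarrow> mult_op R r \<in> diff_ops_lt (Suc 0)"
  using diff_ops_le_eq_lt[of 0] by auto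

lemma diff_op_subring: "subring (carrier D) E"
proof (rule E.subringI)
  have "\<one>\<^bsub>E\<^esub> = mult_op R \<one>"
    by (rule lin_End_eqI) (auto simp: mult_op_apply lin_End_apply)
  then show "\<one>\<^bsub>E\<^esub> \<in> carrier D"
    using mult_op_in_diff_ops_lt[of \<one>] unfolding diff_op_carrier by (metis UN_I UNIV_I one_closed)
next
  fix \<delta> \<epsilon> assume "\<delta> \<in> carrier D" "\<epsilon> \<in> carrier D"
  then obtain m n where mn: "\<delta> \<in> diff_ops_lt m" "\<epsilon> \<in> diff_ops_lt n" by (auto simp: diff_op_carrier)
  then show "\<delta> \<otimes>\<^bsub>E\<^esub> \<epsilon> \<in> carrier D"
    using diff_ops_lt_mult unfolding diff_op_carrier by blast
  have "\<delta> \<in> diff_ops_lt (m + n)" "\<epsilon> \<in> diff_ops_lt (m + n)"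
    using mn diff_ops_lt_mono[of m "m + n"] diff_ops_lt_mono[of n "m + n"] by auto
  then show "\<delta> \<oplus>\<^bsub>E\<^esub> \<epsilon> \<in> carrier D"
    using diff_ops_lt_add unfolding diff_op_carrier by blast
next
  fix \<delta> assume "\<delta> \<in> carrier D"
  then show "\<ominus>\<^bsub>E\<^esub> \<delta> \<in> carrier D"
    using diff_ops_lt_uminus unfolding diff_op_carrier by blast
qed auto

lemma diff_op_ring_simps [simp]:
  "monoid.mult D = monoid.mult E" "ring.add D = ring.add E" "\<zero>\<^bsub>D\<^esub> = \<zero>\<^bsub>E\<^esub>" "\<one>\<^bsub>D\<^esub> = \<one>\<^bsub>E\<^esub>"
  by (simp_all add: diff_op_ring_def)

sublocale D: ring "diff_op_ring A R"
  using E.subring_is_ring[OF diff_op_subring] by (simp add: diff_op_ring_def)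

end

section \<open>The numerator of the action on a fraction\<close>

context cring_with_scalars
begin

text \<open>
  The recursion \<open>\<delta> \<cdot> (v / g) = (\<delta> v - [\<delta>, g] \<cdot> (v / g)) / g\<close> with denominators cleared: for \<open>\<delta>\<close> of
  order less than \<open>m\<close>, this is the numerator of \<open>\<delta> \<cdot> (v / g)\<close> over the denominator \<open>g\<^sup>m\<close>. It makes sense
  for any function \<open>\<delta>\<close>, so it can be applied to sums, multiples and shifts of operators without
  first placing them in \<open>Hom\<^sub>A(R, R)\<close>.
\<close>

primrec act_num :: "nat \<Rightarrow> ('a \<Rightarrow> 'a) \<Rightarrow> 'a \<Rightarrow> 'a \<Rightarrow> 'a"
  where
    "act_num 0 \<delta> v g = \<zero>"
  | "act_num (Suc m) \<delta> v g =
      g [^] m \<otimes> \<delta> v \<ominus> act_num m (\<lambda>x. \<delta> (g \<otimes> x) \<ominus> g \<otimes> \<delta> x) v g"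

lemma act_num_closed [simp]:
  "\<delta> \<in> carrier R \<rightarrow> carrier R \<Longrightarrow> v \<in> carrier R \<Longrightarrow> g \<in> carrier R \<Longrightarrow>
    act_num m \<delta> v g \<in> carrier R"
proof (induction m arbitrary: \<delta>)
  case (Suc m)
  have "act_num m (\<lambda>x. \<delta> (g \<otimes> x) \<ominus> g \<otimes> \<delta> x) v g \<in> carrier R"
    using Suc.prems by (intro Suc.IH) auto
  moreover have "\<delta> v \<in> carrier R" using Suc.prems by blast
  ultimately show ?case using Suc.prems by simp
qed simp

lemma act_num_cong:
  assumes "\<And>x. x \<in> carrier R \<Longrightarrow> \<delta> x = \<epsilon> x" "v \<in> carrier R" "g \<in> carrier R"
  shows "act_num m \<delta> v g = act_num m \<epsilon> v g"
  using assms(1)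
proof (induction m arbitrary: \<delta> \<epsilon>)
  case (Suc m)
  have "act_num m (\<lambda>x. \<delta> (g \<otimes> x) \<ominus> g \<otimes> \<delta> x) v g = act_num m (\<lambda>x. \<epsilon> (g \<otimes> x) \<ominus> g \<otimes> \<epsilon> x) v g"
    using Suc.prems assms by (intro Suc.IH) simp
  then show ?case using Suc.prems assms by simp
qed simp

lemma act_num_add:
  assumes "\<delta> \<in> carrier R \<rightarrow> carrier R" "\<epsilon> \<in> carrier R \<rightarrow> carrier R"
    and "\<And>x. x \<in> carrier R \<Longrightarrow> \<gamma> x = \<delta> x \<oplus> \<epsilon> x"
    and vg: "v \<in> carrier R" "g \<in> carrier R"
  shows "act_num m \<gamma> v g = act_num m \<delta> v g \<oplus> act_num m \<epsilon> v g"
  using assms(1-3)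
proof (induction m arbitrary: \<gamma> \<delta> \<epsilon>)
  case (Suc m)
  have clos: "\<delta> x \<in> carrier R" "\<epsilon> x \<in> carrier R" if "x \<in> carrier R" for x
    using Suc.prems that by blast+
  let ?c = "\<lambda>\<delta> x. \<delta> (g \<otimes> x) \<ominus> g \<otimes> \<delta> x"
  have "?c \<gamma> x = ?c \<delta> x \<oplus> ?c \<epsilon> x" if "x \<in> carrier R" for x
    using that vg clos[of x] clos[of "g \<otimes> x"] Suc.prems(3)
    by (simp add: a_minus_def r_distr minus_add a_ac)
  moreover have cc: "?c \<delta> \<in> carrier R \<rightarrow> carrier R" "?c \<epsilon> \<in> carrier R \<rightarrow> carrier R"
    using vg clos by auto
  ultimately have "act_num m (?c \<gamma>) v g = act_num m (?c \<delta>) v g \<oplus> act_num m (?c \<epsilon>) v g"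
    by (intro Suc.IH) auto
  then show ?case
    using vg clos Suc.prems(3) act_num_closed[OF cc(1) vg, of m] act_num_closed[OF cc(2) vg, of m]
    by (simp add: a_minus_def r_distr minus_add a_ac)
qed simp

lemma act_num_scale:
  assumes "\<delta> \<in> carrier R \<rightarrow> carrier R" "\<And>x. x \<in> carrier R \<Longrightarrow> \<gamma> x = h \<otimes> \<delta> x"
    and vg: "v \<in> carrier R" "g \<in> carrier R" "h \<in> carrier R"
  shows "act_num m \<gamma> v g = h \<otimes> act_num m \<delta> v g"
  using assms(1,2)
proof (induction m arbitrary: \<gamma> \<delta>)
  case (Suc m)
  have clos: "\<delta> x \<in> carrier R" if "x \<in> carrier R" for x
    using Suc.prems that by blast+
  let ?c = "\<lambda>\<delta> x. \<delta> (g \<otimes> x) \<ominus> g \<otimes> \<delta> x"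
  have "?c \<gamma> x = h \<otimes> ?c \<delta> x" if "x \<in> carrier R" for x
    using that vg clos[of x] clos[of "g \<otimes> x"] Suc.prems(2)
    by (simp add: a_minus_def r_distr r_minus m_lcomm)
  moreover have cc: "?c \<delta> \<in> carrier R \<rightarrow> carrier R"
    using vg clos by auto
  ultimately have "act_num m (?c \<gamma>) v g = h \<otimes> act_num m (?c \<delta>) v g"
    by (intro Suc.IH) auto
  then show ?case
    using vg clos Suc.prems(2) act_num_closed[OF cc vg(1,2), of m]
    by (simp add: a_minus_def r_distr r_minus m_lcomm)
qed (use vg in simp)

text \<open>
  Taking brackets with \<open>g\<close> commutes with precomposition by multiplication by \<open>g\<close>.
\<close>

lemma act_num_shift:
  assumes "\<delta> \<in> carrier R \<rightarrow> carrier R" "\<And>x. x \<in> carrier R \<Longrightarrow> \<gamma> x = \<delta> (g \<otimes> x)"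
    and vg: "v \<in> carrier R" "g \<in> carrier R"
  shows "act_num m \<gamma> v g = act_num m \<delta> (g \<otimes> v) g"
  using assms(1,2)
proof (induction m arbitrary: \<gamma> \<delta>)
  case (Suc m)
  have clos: "\<delta> x \<in> carrier R" if "x \<in> carrier R" for x
    using Suc.prems that by blast+
  let ?c = "\<lambda>\<delta> x. \<delta> (g \<otimes> x) \<ominus> g \<otimes> \<delta> x"
  have "?c \<gamma> x = ?c \<delta> (g \<otimes> x)" if "x \<in> carrier R" for x
    using that vg Suc.prems(2) by simp
  moreover have "?c \<delta> \<in> carrier R \<rightarrow> carrier R"
    using vg clos by auto
  ultimately have "act_num m (?c \<gamma>) v g = act_num m (?c \<delta>) (g \<otimes> v) g"
    by (intro Suc.IH) auto
  then show ?case
    using vg Suc.prems(2) by simp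
qed simp

lemma act_num_zero:
  assumes "\<And>x. x \<in> carrier R \<Longrightarrow> \<delta> x = \<zero>" "v \<in> carrier R" "g \<in> carrier R"
  shows "act_num m \<delta> v g = \<zero>"
  using assms(1)
proof (induction m arbitrary: \<delta>)
  case (Suc m)
  have "act_num m (\<lambda>x. \<delta> (g \<otimes> x) \<ominus> g \<otimes> \<delta> x) v g = \<zero>"
    using assms Suc.prems by (intro Suc.IH) (simp add: a_minus_def)
  then show ?case
    using assms Suc.prems by (simp add: a_minus_def)
qed simp

lemma lin_End_funcset: "\<delta> \<in> carrier E \<Longrightarrow> \<delta> \<in> carrier R \<rightarrow> carrier R"
  by auto

lemma act_num_lin_End_closed:
  "\<delta> \<in> carrier E \<Longrightarrow> v \<in> carrier R \<Longrightarrow> g \<in> carrier R \<Longrightarrow> act_num m \<delta> v g \<in> carrier R"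
  by (rule act_num_closed[OF lin_End_funcset])

lemma act_num_Suc_lin_End:
  assumes "\<delta> \<in> carrier E" "v \<in> carrier R" "g \<in> carrier R"
  shows "act_num (Suc m) \<delta> v g = g [^] m \<otimes> \<delta> v \<ominus> act_num m (op_bracket A R \<delta> g) v g"
  using assms act_num_cong[of "op_bracket A R \<delta> g" "\<lambda>x. \<delta> (g \<otimes> x) \<ominus> g \<otimes> \<delta> x" v g m]
  by (simp add: op_bracket_apply)

text \<open>
  An overestimate of the order by one multiplies numerator and denominator by \<open>g\<close>. In the shifted
  filtration the induction starts at \<open>\<delta> = 0\<close>, where both sides vanish.
\<close>

lemma act_num_order_Suc:
  "\<delta> \<in> diff_ops_lt m \<Longrightarrow> v \<in> carrier R \<Longrightarrow> g \<in> carrier R \<Longrightarrow>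
    act_num (Suc m) \<delta> v g = g \<otimes> act_num m \<delta> v g"
proof (induction m arbitrary: \<delta>)
  case 0
  then show ?case by (simp add: act_num_zero lin_End_apply a_minus_def)
next
  case (Suc m)
  then have E: "\<delta> \<in> carrier E" "op_bracket A R \<delta> g \<in> carrier E" by auto
  have "act_num (Suc m) (op_bracket A R \<delta> g) v g = g \<otimes> act_num m (op_bracket A R \<delta> g) v g"
    using Suc by (intro Suc.IH) auto
  then show ?case
    using Suc.prems E act_num_lin_End_closed[OF E(2) Suc.prems(2,3), of m]
    by (simp add: act_num_Suc_lin_End a_minus_def r_distr r_minus m_ac del: act_num.simps)
qed

lemma act_num_order_mono:
  assumes "\<delta> \<in> diff_ops_lt m" "v \<in> carrier R" "g \<in> carrier R"
  shows "act_num (m + k) \<delta> v g = g [^] k \<otimes> act_num m \<delta> v g"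
proof (induction k)
  case 0
  have "\<delta> \<in> carrier E" using assms diff_ops_lt_subset by blast
  then show ?case using assms act_num_lin_End_closed[of \<delta> v g m] by simp
next
  case (Suc k)
  have E: "\<delta> \<in> carrier E" using assms diff_ops_lt_subset by blast
  have "\<delta> \<in> diff_ops_lt (m + k)" using assms diff_ops_lt_mono[of m "m + k"] by auto
  then have "act_num (m + Suc k) \<delta> v g = g \<otimes> act_num (m + k) \<delta> v g"
    using act_num_order_Suc assms by simp
  then show ?case
    using Suc assms act_num_lin_End_closed[OF E, of v g m]
    by (simp add: m_ac)
qed

text \<open>
  The action extends the one on the ring: \<open>\<delta> \<cdot> (g v / g) = \<delta> v\<close>.
\<close>

lemma act_num_cancel:
  "\<delta> \<in> diff_ops_lt m \<Longrightarrow> v \<in> carrier R \<Longrightarrow> g \<in> carrier R \<Longrightarrow>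
    act_num m \<delta> (g \<otimes> v) g = g [^] m \<otimes> \<delta> v"
proof (induction m arbitrary: \<delta>)
  case 0
  then show ?case by (simp add: lin_End_apply)
next
  case (Suc m)
  then have E: "\<delta> \<in> carrier E" by auto
  have "act_num m (op_bracket A R \<delta> g) (g \<otimes> v) g = g [^] m \<otimes> op_bracket A R \<delta> g v"
    using Suc by (intro Suc.IH) auto
  then have "act_num (Suc m) \<delta> (g \<otimes> v) g =
      g [^] m \<otimes> \<delta> (g \<otimes> v) \<ominus> g [^] m \<otimes> (\<delta> (g \<otimes> v) \<ominus> g \<otimes> \<delta> v)"
    using Suc.prems E
    by (simp add: act_num_Suc_lin_End op_bracket_apply del: act_num.simps)
  also have "\<dots> = g [^] m \<otimes> g \<otimes> \<delta> v"
  proof -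
    have "p \<otimes> x \<ominus> p \<otimes> (x \<ominus> g \<otimes> y) = p \<otimes> g \<otimes> y"
      if "p \<in> carrier R" "x \<in> carrier R" "y \<in> carrier R" for p x y
      using that Suc.prems(3) by algebra
    then show ?thesis using Suc.prems E by simp
  qed
  finally show ?case by simp
qed

text \<open>
  Independence of the representative. Splitting the bracket as
  \<open>[\<delta>, h g] = [\<delta>, h] g + h [\<delta>, g]\<close> leaves a term \<open>[\<delta>, h] \<cdot> (g v / g)\<close>, where \<open>g\<close> cancels, and
  a term \<open>h [\<delta>, g]\<close>, from which \<open>h\<close> can be pulled out.
\<close>

lemma act_num_expand_fraction:
  "\<delta> \<in> diff_ops_lt m \<Longrightarrow> v \<in> carrier R \<Longrightarrow> g \<in> carrier R \<Longrightarrow> h \<in> carrier R \<Longrightarrow>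
    act_num m \<delta> (h \<otimes> v) (h \<otimes> g) = h [^] m \<otimes> act_num m \<delta> v g"
proof (induction m arbitrary: \<delta>)
  case (Suc m)
  note vgh = Suc.prems(2-4)
  have E: "\<delta> \<in> carrier E" using Suc.prems by auto
  let ?B = "op_bracket A R \<delta>"
  have Bh: "?B h \<in> diff_ops_lt m" and Bg: "?B g \<in> carrier E" using Suc.prems by auto
  have BhE: "?B h \<in> carrier E" using E vgh by simp
  have cl: "act_num m (?B g) v g \<in> carrier R"
    using act_num_lin_End_closed[OF Bg] vgh by simp
  have "act_num m (?B (h \<otimes> g)) (h \<otimes> v) (h \<otimes> g) = h [^] m \<otimes> act_num m (?B (h \<otimes> g)) v g"
    using Suc.prems by (intro Suc.IH) auto
  moreover have "act_num m (?B (h \<otimes> g)) v g =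
      act_num m (\<lambda>x. ?B h (g \<otimes> x)) v g \<oplus> act_num m (\<lambda>x. h \<otimes> ?B g x) v g"
  proof (rule act_num_add)
    fix x assume x: "x \<in> carrier R"
    have "a \<ominus> (h \<otimes> g) \<otimes> c = (a \<ominus> h \<otimes> b) \<oplus> h \<otimes> (b \<ominus> g \<otimes> c)"
      if "a \<in> carrier R" "b \<in> carrier R" "c \<in> carrier R" for a b c
      using that vgh by algebra
    from this[of "\<delta> ((h \<otimes> g) \<otimes> x)" "\<delta> (g \<otimes> x)" "\<delta> x"]
    show "?B (h \<otimes> g) x = ?B h (g \<otimes> x) \<oplus> h \<otimes> ?B g x"
      using vgh x E by (simp add: op_bracket_apply m_assoc)
  qed (use vgh BhE Bg in auto)
  moreover have "act_num m (\<lambda>x. ?B h (g \<otimes> x)) v g = g [^] m \<otimes> ?B h v"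
    using act_num_shift[of "?B h" "\<lambda>x. ?B h (g \<otimes> x)" g v m] act_num_cancel[OF Bh] vgh BhE
    by auto
  moreover have "act_num m (\<lambda>x. h \<otimes> ?B g x) v g = h \<otimes> act_num m (?B g) v g"
    using vgh Bg by (intro act_num_scale) auto
  ultimately have "act_num (Suc m) \<delta> (h \<otimes> v) (h \<otimes> g) =
      (h [^] m \<otimes> g [^] m) \<otimes> \<delta> (h \<otimes> v) \<ominus>
      h [^] m \<otimes> (g [^] m \<otimes> (\<delta> (h \<otimes> v) \<ominus> h \<otimes> \<delta> v) \<oplus> h \<otimes> act_num m (?B g) v g)"
    using vgh E
    by (simp add: act_num_Suc_lin_End op_bracket_apply nat_pow_distrib del: act_num.simps)
  also have "\<dots> = h [^] m \<otimes> h \<otimes> (g [^] m \<otimes> \<delta> v \<ominus> act_num m (?B g) v g)"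
  proof -
    have "(p \<otimes> q) \<otimes> x \<ominus> p \<otimes> (q \<otimes> (x \<ominus> h \<otimes> y) \<oplus> h \<otimes> z) = p \<otimes> h \<otimes> (q \<otimes> y \<ominus> z)"
      if "p \<in> carrier R" "q \<in> carrier R" "x \<in> carrier R" "y \<in> carrier R" "z \<in> carrier R"
      for p q x y z
      using that vgh by algebra
    then show ?thesis using vgh E cl by simp
  qed
  finally show ?case
    using vgh E by (simp add: act_num_Suc_lin_End del: act_num.simps)
qed simp

end

section \<open>The localization at the powers of an element\<close>

locale cring_with_element = cring R for R (structure) +
  fixes f :: 'a
  assumes f_closed [simp]: "f \<in> carrier R"
begin

abbreviation L where "L \<equiv> loc_ring R f"
abbreviation frac where "frac \<equiv> loc_frac R f"

lemma pow_f_closed [simp]: "f [^] (n::nat) \<in> carrier R"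
  by simp

lemma pow_f_add: "f [^] (m + n :: nat) = f [^] m \<otimes> f [^] n"
  by (simp add: nat_pow_mult)

lemma loc_relI:
  "v \<in> carrier R \<Longrightarrow> w \<in> carrier R \<Longrightarrow>
    f [^] (k::nat) \<otimes> (f [^] u \<otimes> v) = f [^] k \<otimes> (f [^] t \<otimes> w) \<Longrightarrow> ((v, t), (w, u)) \<in> loc_rel R f"
  unfolding loc_rel_def by blast

lemma loc_relE:
  assumes "((v, t), (w, u)) \<in> loc_rel R f"
  obtains k :: nat where "v \<in> carrier R" "w \<in> carrier R"
    "f [^] k \<otimes> (f [^] u \<otimes> v) = f [^] k \<otimes> (f [^] t \<otimes> w)"
  using assms unfolding loc_rel_def by blast

lemma loc_rel_equiv: "equiv (carrier R \<times> UNIV) (loc_rel R f)"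
proof (rule equivI)
  show "loc_rel R f \<subseteq> (carrier R \<times> UNIV) \<times> (carrier R \<times> UNIV)"
    unfolding loc_rel_def by auto
  show "refl_on (carrier R \<times> UNIV) (loc_rel R f)"
    unfolding loc_rel_def refl_on_def by auto
  show "sym (loc_rel R f)"
    unfolding loc_rel_def sym_def by auto metis
  show "trans (loc_rel R f)"
  proof (rule transI, clarify)
    fix v t w u x s
    assume "((v, t), (w, u)) \<in> loc_rel R f" "((w, u), (x, s)) \<in> loc_rel R f"
    then obtain k l :: nat where c: "v \<in> carrier R" "w \<in> carrier R" "x \<in> carrier R"
      and kl: "f [^] k \<otimes> (f [^] u \<otimes> v) = f [^] k \<otimes> (f [^] t \<otimes> w)"
        "f [^] l \<otimes> (f [^] s \<otimes> w) = f [^] l \<otimes> (f [^] u \<otimes> x)"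
      by (elim loc_relE) (rule that; assumption)
    have gen: "((a \<otimes> b) \<otimes> c) \<otimes> (d \<otimes> y) = (b \<otimes> d) \<otimes> (a \<otimes> (c \<otimes> y))"
      if "a \<in> carrier R" "b \<in> carrier R" "c \<in> carrier R" "d \<in> carrier R" "y \<in> carrier R"
      for a b c d y
      using that by algebra
    have gen': "(b \<otimes> d) \<otimes> (a \<otimes> (c \<otimes> y)) = (a \<otimes> c) \<otimes> (b \<otimes> (d \<otimes> y))"
      if "a \<in> carrier R" "b \<in> carrier R" "c \<in> carrier R" "d \<in> carrier R" "y \<in> carrier R"
      for a b c d y
      using that by algebra
    have "f [^] (k + l + u) \<otimes> (f [^] s \<otimes> v) =
        (f [^] l \<otimes> f [^] s) \<otimes> (f [^] k \<otimes> (f [^] u \<otimes> v))"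
      unfolding pow_f_add using c by (intro gen) auto
    also have "\<dots> = (f [^] l \<otimes> f [^] s) \<otimes> (f [^] k \<otimes> (f [^] t \<otimes> w))"
      by (simp only: kl)
    also have "\<dots> = (f [^] k \<otimes> f [^] t) \<otimes> (f [^] l \<otimes> (f [^] s \<otimes> w))"
      using c by (intro gen') auto
    also have "\<dots> = (f [^] k \<otimes> f [^] t) \<otimes> (f [^] l \<otimes> (f [^] u \<otimes> x))"
      by (simp only: kl)
    also have "\<dots> = f [^] (k + l + u) \<otimes> (f [^] t \<otimes> x)"
    proof -
      have "(a \<otimes> b) \<otimes> (c \<otimes> (d \<otimes> y)) = ((a \<otimes> c) \<otimes> d) \<otimes> (b \<otimes> y)"
        if "a \<in> carrier R" "b \<in> carrier R" "c \<in> carrier R" "d \<in> carrier R" "y \<in> carrier R"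
        for a b c d y
        using that by algebra
      then show ?thesis unfolding pow_f_add using c by auto
    qed
    finally show "((v, t), (x, s)) \<in> loc_rel R f" using c by (intro loc_relI) auto
  qed
qed

lemma frac_eq_iff:
  assumes "v \<in> carrier R" "w \<in> carrier R"
  shows "frac v t = frac w u \<longleftrightarrow>
    (\<exists>k::nat. f [^] k \<otimes> (f [^] u \<otimes> v) = f [^] k \<otimes> (f [^] t \<otimes> w))"
  unfolding loc_frac_def
  using assms eq_equiv_class_iff[OF loc_rel_equiv, of "(v, t)" "(w, u)"]
  by (auto simp: loc_rel_def)

lemma frac_eqI:
  assumes "v \<in> carrier R" "w \<in> carrier R" "f [^] u \<otimes> v = f [^] t \<otimes> w"
  shows "frac v t = frac w u"
  using assms by (auto simp: frac_eq_iff)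

lemma frac_self: "v \<in> carrier R \<Longrightarrow> (v, t) \<in> frac v t"
  unfolding loc_frac_def using loc_rel_equiv by (auto simp: equiv_def refl_on_def)

lemma frac_memberE:
  assumes "(w, u) \<in> frac v t" "v \<in> carrier R"
  obtains k :: nat where "w \<in> carrier R" "f [^] k \<otimes> (f [^] u \<otimes> v) = f [^] k \<otimes> (f [^] t \<otimes> w)"
  using assms unfolding loc_frac_def by (auto elim: loc_relE)

lemma frac_expand:
  assumes "v \<in> carrier R"
  shows "frac (f [^] k \<otimes> v) (k + t) = frac v t"
  using assms by (intro frac_eqI) (auto simp: pow_f_add m_ac)

text \<open>
  The operations on fractions are unions over all representatives. This reduces each of them to
  checking that one value is taken throughout the class.
\<close>

lemma Union_frac_eq:
  fixes F :: "'a \<Rightarrow> nat \<Rightarrow> 'c set" and Y :: "'c set"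
  assumes "v \<in> carrier R"
    "\<And>w u k. w \<in> carrier R \<Longrightarrow> f [^] (k::nat) \<otimes> (f [^] u \<otimes> v) = f [^] k \<otimes> (f [^] t \<otimes> w) \<Longrightarrow> F w u = Y"
  shows "(\<Union>(w, u)\<in>frac v t. F w u) = Y"
proof -
  have "F w u = Y" if "(w, u) \<in> frac v t" for w u
    using frac_memberE[OF that assms(1)] assms(2) by metis
  then show ?thesis using frac_self[OF assms(1), of t] by blast
qed

lemma frac_mult:
  assumes v: "v \<in> carrier R" and w: "w \<in> carrier R"
  shows "frac v t \<otimes>\<^bsub>L\<^esub> frac w u = frac (v \<otimes> w) (t + u)"
proof -
  have "(\<Union>(v', t')\<in>frac v t. \<Union>(w', u')\<in>frac w u. frac (v' \<otimes> w') (t' + u')) = frac (v \<otimes> w) (t + u)"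
  proof (intro Union_frac_eq v w)
    fix v' w' and t' k u' l :: nat
    assume c: "v' \<in> carrier R" "w' \<in> carrier R"
      and k: "f [^] (k::nat) \<otimes> (f [^] t' \<otimes> v) = f [^] k \<otimes> (f [^] t \<otimes> v')"
      and l: "f [^] (l::nat) \<otimes> (f [^] u' \<otimes> w) = f [^] l \<otimes> (f [^] u \<otimes> w')"
    have gen: "(a \<otimes> b) \<otimes> ((c \<otimes> d) \<otimes> (x \<otimes> y)) = (a \<otimes> (c \<otimes> x)) \<otimes> (b \<otimes> (d \<otimes> y))"
      if "a \<in> carrier R" "b \<in> carrier R" "c \<in> carrier R" "d \<in> carrier R" "x \<in> carrier R" "y \<in> carrier R"
      for a b c d x y
      using that by algebra
    have "f [^] (k + l) \<otimes> (f [^] (t + u) \<otimes> (v' \<otimes> w')) = f [^] (k + l) \<otimes> (f [^] (t' + u') \<otimes> (v \<otimes> w))"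
      unfolding pow_f_add using c v w by (simp add: gen k l)
    then show "frac (v' \<otimes> w') (t' + u') = frac (v \<otimes> w) (t + u)"
      using c v w unfolding frac_eq_iff[OF m_closed[OF c] m_closed[OF v w]] by blast
  qed
  then show ?thesis by (simp add: loc_ring_def)
qed

lemma frac_add:
  assumes v: "v \<in> carrier R" and w: "w \<in> carrier R"
  shows "frac v t \<oplus>\<^bsub>L\<^esub> frac w u = frac (f [^] u \<otimes> v \<oplus> f [^] t \<otimes> w) (t + u)"
proof -
  have "(\<Union>(v', t')\<in>frac v t. \<Union>(w', u')\<in>frac w u. frac (f [^] u' \<otimes> v' \<oplus> f [^] t' \<otimes> w') (t' + u')) =
      frac (f [^] u \<otimes> v \<oplus> f [^] t \<otimes> w) (t + u)"
  proof (intro Union_frac_eq v w)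
    fix v' w' and t' k u' l :: nat
    assume c: "v' \<in> carrier R" "w' \<in> carrier R"
      and k: "f [^] (k::nat) \<otimes> (f [^] t' \<otimes> v) = f [^] k \<otimes> (f [^] t \<otimes> v')"
      and l: "f [^] (l::nat) \<otimes> (f [^] u' \<otimes> w) = f [^] l \<otimes> (f [^] u \<otimes> w')"
    have gen: "(a \<otimes> b) \<otimes> ((p \<otimes> q) \<otimes> (q' \<otimes> x \<oplus> p' \<otimes> y)) =
        (b \<otimes> q \<otimes> q') \<otimes> (a \<otimes> (p \<otimes> x)) \<oplus> (a \<otimes> p \<otimes> p') \<otimes> (b \<otimes> (q \<otimes> y))"
      if "a \<in> carrier R" "b \<in> carrier R" "p \<in> carrier R" "q \<in> carrier R"
        "p' \<in> carrier R" "q' \<in> carrier R" "x \<in> carrier R" "y \<in> carrier R"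
      for a b p q p' q' x y
      using that by algebra
    have comm: "b \<otimes> q \<otimes> q' = b \<otimes> q' \<otimes> q"
      if "b \<in> carrier R" "q \<in> carrier R" "q' \<in> carrier R" for b q q'
      using that by algebra
    have "f [^] (k + l) \<otimes> (f [^] (t + u) \<otimes> (f [^] u' \<otimes> v' \<oplus> f [^] t' \<otimes> w')) =
        (f [^] l \<otimes> f [^] u \<otimes> f [^] u') \<otimes> (f [^] k \<otimes> (f [^] t' \<otimes> v)) \<oplus>
        (f [^] k \<otimes> f [^] t \<otimes> f [^] t') \<otimes> (f [^] l \<otimes> (f [^] u' \<otimes> w))"
      unfolding pow_f_add using c by (simp add: gen k l)
    also have "\<dots> = f [^] (k + l) \<otimes> (f [^] (t' + u') \<otimes> (f [^] u \<otimes> v \<oplus> f [^] t \<otimes> w))"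
      unfolding pow_f_add using v w
      by (subst gen) (auto simp: comm[of "f [^] l" "f [^] u"] comm[of "f [^] k" "f [^] t"])
    finally show "frac (f [^] u' \<otimes> v' \<oplus> f [^] t' \<otimes> w') (t' + u') =
        frac (f [^] u \<otimes> v \<oplus> f [^] t \<otimes> w) (t + u)"
      using c v w by (subst frac_eq_iff) auto
  qed
  then show ?thesis by (simp add: loc_ring_def)
qed

lemma frac_closed [simp]: "v \<in> carrier R \<Longrightarrow> frac v t \<in> carrier L"
  by (auto simp: loc_ring_def loc_frac_def quotient_def)

lemma loc_carrierE:
  assumes "P \<in> carrier L"
  obtains v t where "v \<in> carrier R" "P = frac v t"
  using assms by (auto simp: loc_ring_def loc_frac_def quotient_def)

lemma frac_zero: "frac \<zero> t = \<zero>\<^bsub>L\<^esub>"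
proof -
  have "frac \<zero> t = frac \<zero> 0" by (rule frac_eqI) auto
  then show ?thesis by (simp add: loc_ring_def)
qed

lemma frac_one: "\<one>\<^bsub>L\<^esub> = frac \<one> 0"
  by (simp add: loc_ring_def)

lemma loc_cring: "cring L"
proof (rule cringI)
  show "abelian_group L"
  proof (rule abelian_groupI)
    fix P Q assume "P \<in> carrier L" "Q \<in> carrier L"
    then obtain v t w u where [simp]: "v \<in> carrier R" "w \<in> carrier R"
      and PQ: "P = frac v t" "Q = frac w u" by (elim loc_carrierE)
    show "P \<oplus>\<^bsub>L\<^esub> Q \<in> carrier L" by (simp add: PQ frac_add)
    show "P \<oplus>\<^bsub>L\<^esub> Q = Q \<oplus>\<^bsub>L\<^esub> P" by (simp add: PQ frac_add a_comm add.commute)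
  next
    fix P Q Z assume "P \<in> carrier L" "Q \<in> carrier L" "Z \<in> carrier L"
    then obtain v t w u z s where [simp]: "v \<in> carrier R" "w \<in> carrier R" "z \<in> carrier R"
      and PQ: "P = frac v t" "Q = frac w u" "Z = frac z s" by (elim loc_carrierE)
    show "P \<oplus>\<^bsub>L\<^esub> Q \<oplus>\<^bsub>L\<^esub> Z = P \<oplus>\<^bsub>L\<^esub> (Q \<oplus>\<^bsub>L\<^esub> Z)"
      by (simp add: PQ frac_add r_distr pow_f_add a_assoc m_ac add.assoc)
  next
    show "\<zero>\<^bsub>L\<^esub> \<in> carrier L" by (simp flip: frac_zero[of 0])
  next
    fix P assume "P \<in> carrier L"
    then obtain v t where [simp]: "v \<in> carrier R" and P: "P = frac v t" by (elim loc_carrierE)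
    show "\<zero>\<^bsub>L\<^esub> \<oplus>\<^bsub>L\<^esub> P = P" by (simp add: P frac_add flip: frac_zero[of 0])
    have "frac (\<ominus> v) t \<oplus>\<^bsub>L\<^esub> P = \<zero>\<^bsub>L\<^esub>"
      by (simp add: P frac_add r_minus l_neg frac_zero)
    then show "\<exists>Q\<in>carrier L. Q \<oplus>\<^bsub>L\<^esub> P = \<zero>\<^bsub>L\<^esub>" by (intro bexI[of _ "frac (\<ominus> v) t"]) auto
  qed
  show "comm_monoid L"
    by (rule comm_monoidI; (elim loc_carrierE)?)
      (auto simp: frac_one frac_mult m_ac add.commute add.left_commute)
next
  fix P Q Z assume "P \<in> carrier L" "Q \<in> carrier L" "Z \<in> carrier L"
  then obtain v t w u z s where [simp]: "v \<in> carrier R" "w \<in> carrier R" "z \<in> carrier R"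
    and PQ: "P = frac v t" "Q = frac w u" "Z = frac z s" by (elim loc_carrierE)
  have "(P \<oplus>\<^bsub>L\<^esub> Q) \<otimes>\<^bsub>L\<^esub> Z = frac ((f [^] u \<otimes> v \<oplus> f [^] t \<otimes> w) \<otimes> z) (t + u + s)"
    by (simp add: PQ frac_add frac_mult)
  also have "\<dots> = frac (f [^] s \<otimes> ((f [^] u \<otimes> v \<oplus> f [^] t \<otimes> w) \<otimes> z)) (s + (t + u + s))"
    by (rule frac_expand[symmetric]) simp
  also have "\<dots> = P \<otimes>\<^bsub>L\<^esub> Z \<oplus>\<^bsub>L\<^esub> Q \<otimes>\<^bsub>L\<^esub> Z"
  proof -
    have "p \<otimes> ((q \<otimes> v \<oplus> r \<otimes> w) \<otimes> z) = (p \<otimes> q) \<otimes> (v \<otimes> z) \<oplus> (p \<otimes> r) \<otimes> (w \<otimes> z)"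
      if "p \<in> carrier R" "q \<in> carrier R" "r \<in> carrier R" for p q r
      using that \<open>v \<in> carrier R\<close> \<open>w \<in> carrier R\<close> \<open>z \<in> carrier R\<close> by algebra
    then show ?thesis
      by (simp add: PQ frac_add frac_mult pow_f_add add_ac)
  qed
  finally show "(P \<oplus>\<^bsub>L\<^esub> Q) \<otimes>\<^bsub>L\<^esub> Z = P \<otimes>\<^bsub>L\<^esub> Z \<oplus>\<^bsub>L\<^esub> Q \<otimes>\<^bsub>L\<^esub> Z" .
qed

sublocale L: cring "loc_ring R f"
  by (rule loc_cring)

lemma frac_minus:
  assumes "v \<in> carrier R" "w \<in> carrier R"
  shows "frac v t \<ominus>\<^bsub>L\<^esub> frac w u = frac (f [^] u \<otimes> v \<ominus> f [^] t \<otimes> w) (t + u)"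
proof -
  have "frac (\<ominus> w) u \<oplus>\<^bsub>L\<^esub> frac w u = \<zero>\<^bsub>L\<^esub>"
    using assms by (simp add: frac_add r_minus l_neg frac_zero)
  then have "\<ominus>\<^bsub>L\<^esub> frac w u = frac (\<ominus> w) u"
    using assms by (intro L.minus_equality) auto
  then show ?thesis
    using assms by (simp add: a_minus_def frac_add r_minus)
qed

lemma frac_int_pow: "frac f 0 [^]\<^bsub>L\<^esub> (e::int) = frac (f [^] nat e) (nat (- e))"
proof -
  have pos: "frac f 0 [^]\<^bsub>L\<^esub> (n::nat) = frac (f [^] n) 0" for n
    by (induction n) (auto simp: frac_one frac_mult)
  have "inv\<^bsub>L\<^esub> (frac (f [^] n) 0) = frac \<one> n" for n :: nat
  proof (rule L.comm_inv_char)
    show "frac (f [^] n) 0 \<otimes>\<^bsub>L\<^esub> frac \<one> n = \<one>\<^bsub>L\<^esub>"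
      by (simp add: frac_mult frac_one) (rule frac_eqI; simp)
  qed auto
  then show ?thesis
    by (simp add: int_pow_def2 pos del: pow_nat)
qed

end

section \<open>The action on fractions in closed form\<close>

locale cring_with_scalars_element =
  cring_with_scalars R A + cring_with_element R f for R (structure) and A and f
begin

lemma loc_act_frac_eq:
  assumes "\<delta> \<in> carrier E" "v \<in> carrier R"
  shows "loc_act_frac A R f m \<delta> v t = frac (act_num (Suc m) \<delta> v (f [^] t)) (t * Suc m)"
  using assms(1)
proof (induction m arbitrary: \<delta>)
  case 0
  then show ?case using assms(2) by (simp add: a_minus_def)
next
  case (Suc m)
  let ?g = "f [^] t"
  let ?B = "op_bracket A R \<delta> ?g"
  have B: "?B \<in> carrier E" using Suc.prems by simp
  have cl: "act_num (Suc m) ?B v ?g \<in> carrier R"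
    by (rule act_num_lin_End_closed[OF B assms(2) pow_f_closed])
  have "loc_act_frac A R f (Suc m) \<delta> v t =
      frac \<one> t \<otimes>\<^bsub>L\<^esub> (frac (\<delta> v) 0 \<ominus>\<^bsub>L\<^esub> frac (act_num (Suc m) ?B v ?g) (t * Suc m))"
    using Suc.IH[OF B] by simp
  also have "\<dots> = frac (f [^] (t * Suc m) \<otimes> \<delta> v \<ominus> act_num (Suc m) ?B v ?g) (t + t * Suc m)"
    using Suc.prems assms(2) cl by (simp add: frac_minus frac_mult del: act_num.simps)
  also have "\<dots> = frac (act_num (Suc (Suc m)) \<delta> v ?g) (t * Suc (Suc m))"
    unfolding act_num_Suc_lin_End[OF Suc.prems assms(2) pow_f_closed] nat_pow_pow[OF f_closed]
    by simp
  finally show ?case .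
qed

text \<open>
  The action computed with any valid bound on the order and with any representative. The minimal order
  that enters the definition of the action need not be known.
\<close>

lemma loc_act_eq:
  assumes \<delta>: "\<delta> \<in> diff_ops_lt (Suc m)" and v: "v \<in> carrier R"
  shows "loc_act A R f \<delta> (frac v t) = frac (act_num (Suc m) \<delta> v (f [^] t)) (t * Suc m)"
proof -
  let ?n = "Suc (diff_op_order A R \<delta>)"
  have n: "\<delta> \<in> diff_ops_lt ?n"
    unfolding diff_op_order_def diff_ops_le_eq_lt by (rule LeastI[of "\<lambda>m. \<delta> \<in> diff_ops_lt (Suc m)"]) (rule \<delta>)
  have nm: "?n \<le> Suc m"
    unfolding diff_op_order_def diff_ops_le_eq_lt using \<delta>
    by (simp only: Suc_le_mono) (rule Least_le)
  have E: "\<delta> \<in> carrier E" using \<delta> by auto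
  have cl: "act_num j \<delta> w (f [^] u) \<in> carrier R" if "w \<in> carrier R" for j w and u :: nat
    by (rule act_num_lin_End_closed[OF E that pow_f_closed])
  have "loc_act A R f \<delta> (frac v t) = frac (act_num ?n \<delta> v (f [^] t)) (t * ?n)"
    unfolding loc_act_def
  proof (rule Union_frac_eq[OF v])
    fix w and u k :: nat
    assume w: "w \<in> carrier R" and k: "f [^] k \<otimes> (f [^] u \<otimes> v) = f [^] k \<otimes> (f [^] t \<otimes> w)"
    \<comment> \<open>Both fractions expand to one and the same pair of numerator and denominator.\<close>
    have num: "f [^] (k + t) \<otimes> w = f [^] (k + u) \<otimes> v"
      using k v w by (simp add: pow_f_add m_assoc)
    have den: "f [^] (k + t) \<otimes> f [^] u = f [^] (k + u) \<otimes> f [^] t"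
      by (simp add: pow_f_add m_ac)
    have "(f [^] (k + t)) [^] ?n \<otimes> act_num ?n \<delta> w (f [^] u) =
        (f [^] (k + u)) [^] ?n \<otimes> act_num ?n \<delta> v (f [^] t)"
      using act_num_expand_fraction[OF n w, of "f [^] u" "f [^] (k + t)"]
        act_num_expand_fraction[OF n v, of "f [^] t" "f [^] (k + u)"]
      unfolding num den by simp
    then have "f [^] (k * ?n) \<otimes> (f [^] (t * ?n) \<otimes> act_num ?n \<delta> w (f [^] u)) =
        f [^] (k * ?n) \<otimes> (f [^] (u * ?n) \<otimes> act_num ?n \<delta> v (f [^] t))"
      unfolding nat_pow_pow[OF f_closed] add_mult_distrib
      by (simp only: pow_f_add m_assoc pow_f_closed cl[OF v] cl[OF w])
    then have "frac (act_num ?n \<delta> w (f [^] u)) (u * ?n) = frac (act_num ?n \<delta> v (f [^] t)) (t * ?n)"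
      using frac_eq_iff[OF cl[OF w] cl[OF v]] by blast
    then show "loc_act_frac A R f (diff_op_order A R \<delta>) \<delta> w u =
        frac (act_num ?n \<delta> v (f [^] t)) (t * ?n)"
      using loc_act_frac_eq[OF E w] by simp
  qed
  also have "\<dots> = frac (act_num (Suc m) \<delta> v (f [^] t)) (t * Suc m)"
  proof -
    obtain j where j: "Suc m = ?n + j" using nm le_Suc_ex by blast
    have "frac (act_num (?n + j) \<delta> v (f [^] t)) (t * (?n + j)) =
        frac (f [^] (t * j) \<otimes> act_num ?n \<delta> v (f [^] t)) (t * j + t * ?n)"
      using act_num_order_mono[OF n v, of "f [^] t" j]
      by (simp only: nat_pow_pow[OF f_closed] pow_f_closed add_mult_distrib2 add.commute)
    then show ?thesis
      unfolding j using frac_expand[OF cl[OF v], of "t * j"] by (simp only:)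
  qed
  finally show ?thesis .
qed

text \<open>The equation that defines a Bernstein--Sato pair, with all denominators cleared.\<close>

lemma bs_equation_iff:
  assumes \<delta>: "\<delta> \<in> diff_ops_lt (Suc m)" and c: "c \<in> carrier R"
  shows "loc_act A R f \<delta> (frac f 0 [^]\<^bsub>L\<^esub> (t + 1)) = frac c 0 \<otimes>\<^bsub>L\<^esub> frac f 0 [^]\<^bsub>L\<^esub> (t :: int) \<longleftrightarrow>
    (\<exists>k::nat.
      f [^] k \<otimes> (f [^] nat (- t) \<otimes> act_num (Suc m) \<delta> (f [^] nat (t + 1)) (f [^] nat (- (t + 1)))) =
      f [^] k \<otimes> (f [^] (nat (- (t + 1)) * Suc m) \<otimes> (c \<otimes> f [^] nat t)))"
proof -
  have E: "\<delta> \<in> carrier E" using \<delta> by auto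
  have "act_num (Suc m) \<delta> (f [^] nat (t + 1)) (f [^] nat (- (t + 1))) \<in> carrier R"
    by (rule act_num_lin_End_closed[OF E pow_f_closed pow_f_closed])
  then show ?thesis
    using c by (simp add: frac_int_pow loc_act_eq[OF \<delta>] frac_mult frac_eq_iff
        del: act_num.simps mult_Suc_right pow_nat)
qed

end


section \<open>Evaluation of polynomials at integers\<close>

context ring
begin

abbreviation int_elem :: "int \<Rightarrow> 'a" where "int_elem t \<equiv> add_pow R t \<one>"

text \<open>
  The degree may be replaced by any bound on it. This matters because applying a map to the
  coefficients can lower the degree.
\<close>

lemma eval_at_int_eq:
  assumes p: "p \<in> carrier (UP R)" and N: "\<And>i. N < i \<Longrightarrow> p i = \<zero>"
  shows "eval_at_int R t p = (\<Oplus>i\<in>{..N}. p i \<otimes> int_elem t [^] i)"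
proof -
  have p': "p \<in> up R" using p by (simp add: UP_def)
  then have coeff: "up_ring.coeff (UP R) p i = p i" for i by (simp add: UP_def)
  have UP: "UP_ring R" by unfold_locales
  have deg: "deg R p \<le> N" using p N by (intro UP_ring.deg_aboveI[OF UP]) (simp_all add: coeff)
  have "(\<Oplus>i\<in>{..deg R p}. p i \<otimes> int_elem t [^] i) = (\<Oplus>i\<in>{..N}. p i \<otimes> int_elem t [^] i)"
  proof (rule add.finprod_mono_neutral_cong_left)
    show "p i \<otimes> int_elem t [^] i = \<zero>" if "i \<in> {..N} - {..deg R p}" for i
      using that UP_ring.deg_aboveD[OF UP _ p, of i] by (simp add: coeff)
  qed (use deg p' in \<open>auto simp: mem_upD\<close>)
  then show ?thesis
    using p by (simp add: eval_at_int_def eval_def coeff)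
qed

lemma UP_coeff_closed:
  assumes "p \<in> carrier (UP R)"
  shows "p i \<in> carrier R"
  using assms by (simp add: UP_def mem_upD)

lemma UP_bounded:
  assumes "p \<in> carrier (UP R)"
  obtains N where "\<forall>i>N. p i = \<zero>"
proof -
  have "p \<in> up R" using assms by (simp add: UP_def)
  then obtain N where "bound \<zero> N p" by auto
  then have "\<forall>i>N. p i = \<zero>" by auto
  then show thesis by (rule that)
qed

lemma UP_carrierI:
  assumes "\<And>i. p i \<in> carrier R" "\<And>i. N < i \<Longrightarrow> p i = \<zero>"
  shows "p \<in> carrier (UP R)"
  using assms by (auto simp: UP_def intro!: mem_upI exI[of _ N])

lemma eval_at_int_closed:
  assumes "p \<in> carrier (UP R)"
  shows "eval_at_int R t p \<in> carrier R"
proof -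
  obtain N where N: "\<forall>i>N. p i = \<zero>"
    using assms by (rule UP_bounded)
  have "eval_at_int R t p = (\<Oplus>i\<in>{..N}. p i \<otimes> int_elem t [^] i)"
    using N by (intro eval_at_int_eq[OF assms]) auto
  then show ?thesis
    using UP_coeff_closed[OF assms] by (auto intro!: finsum_closed)
qed

lemma zero_poly_closed: "(\<lambda>_. \<zero>) \<in> carrier (UP R)"
  by (rule UP_carrierI[of _ 0]) auto

lemma eval_at_int_zero: "eval_at_int R t (\<lambda>_. \<zero>) = \<zero>"
  using eval_at_int_eq[OF zero_poly_closed, of 0 t] by simp

end

context cring_with_scalars
begin

text \<open>
  Multiplication by an integer multiple of \<open>1\<close> commutes with \<open>\<delta>\<close> because \<open>\<delta>\<close> is additive.
\<close>

lemma lin_End_int_pow: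
  assumes "\<delta> \<in> carrier E" "x \<in> carrier R"
  shows "\<delta> (int_elem t [^] (i::nat) \<otimes> x) = int_elem t [^] i \<otimes> \<delta> x"
  using assms(2)
proof (induction i arbitrary: x)
  case 0
  then show ?case using assms(1) by simp
next
  case (Suc i)
  have "\<delta> (add_pow R t y) = add_pow R t (\<delta> y)" if "y \<in> carrier R" for y
    unfolding add_pow_def
    by (rule hom_int_pow) (use assms that in \<open>auto simp: hom_def lin_End_add a_group\<close>)
  then have "\<delta> (int_elem t \<otimes> x) = int_elem t \<otimes> \<delta> x"
    using assms(1) Suc.prems by (simp add: add_pow_ldistr_int)
  then show ?case
    using Suc assms(1) by (simp add: m_assoc)
qed

lemma diff_op_int_pow_apply:
  assumes "x \<in> carrier R"
  shows "(D.int_elem t [^]\<^bsub>D\<^esub> (i::nat)) x = int_elem t [^] i \<otimes> x"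
  using assms
proof (induction i arbitrary: x)
  case 0
  then show ?case by (simp add: lin_End_one_apply)
next
  case (Suc i)
  have "(D.int_elem t) x = add_pow R t (\<one>\<^bsub>D\<^esub> x)"
    unfolding add_pow_def
    by (rule hom_int_pow[of "\<lambda>\<delta>. \<delta> x"])
      (use Suc.prems D.a_group a_group D.one_closed in \<open>auto simp: hom_def lin_End_add_apply\<close>)
  then have "(D.int_elem t) x = int_elem t \<otimes> x"
    using Suc.prems by (simp add: lin_End_one_apply add_pow_ldistr_int)
  then show ?case
    using Suc by (simp add: lin_End_mult_apply m_assoc)
qed

lemma diff_op_finsum_apply:
  assumes "finite I" "g \<in> I \<rightarrow> carrier D" "x \<in> carrier R"
  shows "(\<Oplus>\<^bsub>D\<^esub>i\<in>I. g i) x = (\<Oplus>i\<in>I. g i x)"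
  using assms(1,2)
proof (induction I rule: finite_induct)
  case empty
  then show ?case using assms(3) by (simp add: lin_End_zero_apply)
next
  case (insert j I)
  then have g: "g j \<in> carrier D" "\<And>i. i \<in> I \<Longrightarrow> g i \<in> carrier D" by auto
  have "(\<lambda>i. g i x) \<in> I \<rightarrow> carrier R" using g assms(3) by auto
  then show ?case
    using insert g assms(3) by (simp add: D.finsum_insert finsum_insert lin_End_add_apply)
qed

lemma eval_at_int_apply:
  assumes p: "p \<in> carrier (UP D)" and N: "\<And>i. N < i \<Longrightarrow> p i = \<zero>\<^bsub>E\<^esub>" and x: "x \<in> carrier R"
  shows "eval_at_int D t p x = (\<Oplus>i\<in>{..N}. int_elem t [^] i \<otimes> p i x)"
proof -
  have pD: "p i \<in> carrier D" for i using D.UP_coeff_closed[OF p] .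
  have "eval_at_int D t p x =
      (\<Oplus>\<^bsub>D\<^esub>i\<in>{..N}. p i \<otimes>\<^bsub>D\<^esub> D.int_elem t [^]\<^bsub>D\<^esub> i) x"
    using D.eval_at_int_eq[OF p, of N] N by simp
  also have "\<dots> = (\<Oplus>i\<in>{..N}. (p i \<otimes>\<^bsub>D\<^esub> D.int_elem t [^]\<^bsub>D\<^esub> i) x)"
    using pD x D.m_closed D.nat_pow_closed D.add.int_pow_closed D.one_closed
    by (intro diff_op_finsum_apply) auto
  also have "\<dots> = (\<Oplus>i\<in>{..N}. int_elem t [^] i \<otimes> p i x)"
  proof (rule finsum_cong')
    fix i
    have "(p i \<otimes>\<^bsub>D\<^esub> D.int_elem t [^]\<^bsub>D\<^esub> i) x = p i ((D.int_elem t [^]\<^bsub>D\<^esub> i) x)"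
      using x by (simp add: lin_End_mult_apply)
    then show "(p i \<otimes>\<^bsub>D\<^esub> D.int_elem t [^]\<^bsub>D\<^esub> i) x = int_elem t [^] i \<otimes> p i x"
      using diff_op_int_pow_apply[OF x] lin_End_int_pow[OF _ x] pD by simp
  qed (use pD x in auto)
  finally show ?thesis .
qed

end

text \<open>
  The existence predicate says that \<open>B\<^sub>f\<close> differs from the zero ideal. Membership of zero is what
  turns this into the presence of a nonzero element.
\<close>

lemma (in cring_with_scalars_element) zero_in_bs_ideal:
  assumes "subcring A R"
  shows "\<zero>\<^bsub>UP (R\<lparr>carrier := A\<rparr>)\<^esub> \<in> bs_ideal A R f"
proof -
  interpret A: cring "R\<lparr>carrier := A\<rparr>"
    using subcring_iff[OF scalars_subset] assms by blast
  have "((\<lambda>_. \<zero>\<^bsub>D\<^esub>), (\<lambda>_. \<zero>)) \<in> bs_pairs A R f"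
  proof -
    have "loc_act A R f \<zero>\<^bsub>D\<^esub> (frac f 0 [^]\<^bsub>L\<^esub> (t + 1)) = frac \<zero> 0 \<otimes>\<^bsub>L\<^esub> frac f 0 [^]\<^bsub>L\<^esub> t"
      for t :: int
      using bs_equation_iff[OF zero_in_diff_ops_lt[of "Suc 0"] zero_closed, of t]
      by (simp add: act_num_zero lin_End_zero_apply del: act_num.simps)
    then show ?thesis
      using D.zero_poly_closed A.zero_poly_closed D.eval_at_int_zero A.eval_at_int_zero
      by (simp add: bs_pairs_def)
  qed
  then show ?thesis
    unfolding bs_ideal_def by (force simp: UP_def)
qed

section \<open>Transport of operators along a splitting\<close>

locale split_subring = cring S for S (structure) +
  fixes R A :: "'a set" and \<beta> :: "'a \<Rightarrow> 'a" and f :: 'a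
  assumes subring_R: "subcring R S"
    and scalars_in_R: "A \<subseteq> R"
    and splitting: "is_splitting S R \<beta>"
    and f_in_R: "f \<in> R"
begin

abbreviation T where "T \<equiv> S\<lparr>carrier := R\<rparr>"

lemma R_subset: "R \<subseteq> carrier S"
  using subcringE(1)[OF subring_R] .

lemma R_closed [simp]: "x \<in> R \<Longrightarrow> x \<in> carrier S"
  using R_subset by blast

sublocale S: cring_with_scalars_element S A f
  using scalars_in_R f_in_R R_subset by unfold_locales auto

lemma T_cring: "cring T"
  using subcring_iff[OF R_subset] subring_R by blast

sublocale T: cring_with_scalars_element T A f
proof -
  interpret T: cring T by (rule T_cring)
  show "cring_with_scalars_element T A f"
    using scalars_in_R f_in_R by unfold_locales auto
qed

lemma T_uminus: "x \<in> R \<Longrightarrow> \<ominus>\<^bsub>T\<^esub> x = \<ominus> x"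
  using minus_equality[of "\<ominus>\<^bsub>T\<^esub> x" x] T.l_neg[of x] T.a_inv_closed[of x] by simp

lemma T_minus: "x \<in> R \<Longrightarrow> y \<in> R \<Longrightarrow> x \<ominus>\<^bsub>T\<^esub> y = x \<ominus> y"
  by (simp add: a_minus_def T_uminus)

lemma T_nat_pow: "x [^]\<^bsub>T\<^esub> (n::nat) = x [^] n"
  by (simp add: nat_pow_def)

lemma T_int_elem: "add_pow T t \<one> = int_elem t"
proof -
  have "\<one> \<in> R" using T.one_closed by simp
  then have "(\<lambda>x. x) (add_pow T t \<one>\<^bsub>T\<^esub>) = add_pow S t ((\<lambda>x. x) \<one>\<^bsub>T\<^esub>)"
    unfolding add_pow_def
    by (intro hom_int_pow) (use T.a_group a_group in \<open>auto simp: hom_def\<close>)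
  then show ?thesis by simp
qed

lemma R_ops [simp]:
  "\<one> \<in> R" "\<zero> \<in> R"
  "x \<in> R \<Longrightarrow> y \<in> R \<Longrightarrow> x \<oplus> y \<in> R"
  "x \<in> R \<Longrightarrow> y \<in> R \<Longrightarrow> x \<otimes> y \<in> R"
  "x \<in> R \<Longrightarrow> \<ominus> x \<in> R"
  "x \<in> R \<Longrightarrow> y \<in> R \<Longrightarrow> x \<ominus> y \<in> R"
  "x \<in> R \<Longrightarrow> x [^] (n::nat) \<in> R"
  "a \<in> A \<Longrightarrow> a \<in> R"
  "f \<in> R"
proof -
  show "x [^] (n::nat) \<in> R" if "x \<in> R" using T.nat_pow_closed[of x n] that by (simp add: T_nat_pow)
qed (use subcringE[OF subring_R] scalars_in_R f_in_R in \<open>auto simp: a_minus_def\<close>)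

lemma beta_closed [simp]: "x \<in> carrier S \<Longrightarrow> \<beta> x \<in> R"
  using splitting by (auto simp: is_splitting_def)

lemma beta_add: "x \<in> carrier S \<Longrightarrow> y \<in> carrier S \<Longrightarrow> \<beta> (x \<oplus> y) = \<beta> x \<oplus> \<beta> y"
  using splitting by (auto simp: is_splitting_def)

lemma beta_mult: "r \<in> R \<Longrightarrow> x \<in> carrier S \<Longrightarrow> \<beta> (r \<otimes> x) = r \<otimes> \<beta> x"
  using splitting by (auto simp: is_splitting_def)

lemma beta_id [simp]: "r \<in> R \<Longrightarrow> \<beta> r = r"
  using splitting by (auto simp: is_splitting_def)

lemma beta_minus: "x \<in> carrier S \<Longrightarrow> y \<in> carrier S \<Longrightarrow> \<beta> (x \<ominus> y) = \<beta> x \<ominus> \<beta> y"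
proof -
  assume xy: "x \<in> carrier S" "y \<in> carrier S"
  have "\<beta> (\<ominus> y) \<oplus> \<beta> y = \<zero>"
    using xy beta_add[of "\<ominus> y" y] by (simp add: l_neg)
  then have "\<beta> (\<ominus> y) = \<ominus> \<beta> y"
    using xy minus_equality[of "\<beta> (\<ominus> y)" "\<beta> y"] by simp
  then show "\<beta> (x \<ominus> y) = \<beta> x \<ominus> \<beta> y"
    using xy by (simp add: a_minus_def beta_add)
qed

lemma beta_finsum:
  assumes "finite I" "g \<in> I \<rightarrow> carrier S"
  shows "\<beta> (\<Oplus>i\<in>I. g i) = (\<Oplus>\<^bsub>T\<^esub>i\<in>I. \<beta> (g i))"
  using assms
proof (induction I rule: finite_induct)
  case empty
  then show ?case by simp
next
  case (insert j I)
  then have g: "g j \<in> carrier S" "g \<in> I \<rightarrow> carrier S" by auto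
  then have "(\<lambda>i. \<beta> (g i)) \<in> I \<rightarrow> carrier T" by (auto simp: Pi_iff)
  then show ?case
    using insert g by (simp add: finsum_insert T.finsum_insert beta_add)
qed

definition push :: "('a \<Rightarrow> 'a) \<Rightarrow> 'a \<Rightarrow> 'a"
  where "push \<delta> = (\<lambda>x\<in>R. \<beta> (\<delta> x))"

lemma push_apply: "x \<in> R \<Longrightarrow> push \<delta> x = \<beta> (\<delta> x)"
  by (simp add: push_def)

lemma push_lin_End:
  assumes "\<delta> \<in> carrier S.E"
  shows "push \<delta> \<in> carrier T.E"
  unfolding T.lin_End_carrier_iff using assms
  by (auto simp: push_def S.lin_End_add S.lin_End_scalar beta_add beta_mult)

lemma push_zero: "push \<zero>\<^bsub>S.E\<^esub> = \<zero>\<^bsub>T.E\<^esub>"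
  by (rule T.lin_End_eqI)
    (auto simp: push_lin_End push_apply S.lin_End_zero_apply T.lin_End_zero_apply)

text \<open>
  For \<open>x \<in> R\<close>, the \<open>R\<close>-linearity of \<open>\<beta>\<close> gives \<open>\<beta> (\<delta> (r x) - r \<delta> x) = \<beta> (\<delta> (r x)) - r \<beta> (\<delta> x)\<close>. The
  brackets with elements of \<open>R\<close> are exactly those that determine the order of an operator on \<open>R\<close>.
\<close>

lemma push_op_bracket:
  assumes "\<delta> \<in> carrier S.E" "r \<in> R"
  shows "op_bracket A T (push \<delta>) r = push (op_bracket A S \<delta> r)"
  by (rule T.lin_End_eqI)
    (use assms in \<open>auto simp: push_lin_End push_apply T.op_bracket_apply S.op_bracket_apply
        T_minus beta_minus beta_mult\<close>)

lemma push_diff_ops_lt: "\<delta> \<in> S.diff_ops_lt m \<Longrightarrow> push \<delta> \<in> T.diff_ops_lt m"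
  by (induction m arbitrary: \<delta>) (auto simp: push_zero push_lin_End push_op_bracket)

lemma push_diff_op: "\<delta> \<in> carrier S.D \<Longrightarrow> push \<delta> \<in> carrier T.D"
  using push_diff_ops_lt by (auto simp: S.diff_op_carrier T.diff_op_carrier)

text \<open>
  With \<open>v\<close> and \<open>g\<close> in \<open>R\<close>, the numerator is an \<open>R\<close>-linear combination of values of \<open>\<delta>\<close> at elements of
  \<open>R\<close>, so \<open>\<beta>\<close> passes through it.
\<close>

lemma push_act_num:
  "\<delta> \<in> carrier S.E \<Longrightarrow> v \<in> R \<Longrightarrow> g \<in> R \<Longrightarrow>
    T.act_num m (push \<delta>) v g = \<beta> (S.act_num m \<delta> v g)"
proof (induction m arbitrary: \<delta>)
  case 0
  then show ?case by simp
next
  case (Suc m)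
  have B: "op_bracket A S \<delta> g \<in> carrier S.E" using Suc.prems by simp
  have "T.act_num (Suc m) (push \<delta>) v g =
      g [^] m \<otimes> \<beta> (\<delta> v) \<ominus>\<^bsub>T\<^esub> \<beta> (S.act_num m (op_bracket A S \<delta> g) v g)"
    using Suc B T.act_num_Suc_lin_End[OF push_lin_End, of \<delta> v g m]
    by (simp add: push_op_bracket push_apply T_nat_pow del: T.act_num.simps)
  also have "\<dots> = \<beta> (S.act_num (Suc m) \<delta> v g)"
    using Suc.prems S.act_num_lin_End_closed[OF B, of v g m]
    by (simp add: S.act_num_Suc_lin_End T_minus beta_minus beta_mult del: S.act_num.simps)
  finally show ?case .
qed

lemma push_poly:
  assumes "p \<in> carrier (UP S.D)"
  shows "(\<lambda>i. push (p i)) \<in> carrier (UP T.D)"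
proof -
  obtain N where "\<forall>i>N. p i = \<zero>\<^bsub>S.D\<^esub>" using assms by (rule S.D.UP_bounded)
  then show ?thesis
    using S.D.UP_coeff_closed[OF assms]
    by (intro T.D.UP_carrierI[of _ N]) (auto simp: push_diff_op push_zero)
qed

lemma push_eval_at_int:
  assumes p: "p \<in> carrier (UP S.D)"
  shows "eval_at_int T.D t (\<lambda>i. push (p i)) = push (eval_at_int S.D t p)"
proof (rule T.lin_End_eqI)
  show "eval_at_int T.D t (\<lambda>i. push (p i)) \<in> carrier T.E"
    using T.D.eval_at_int_closed[OF push_poly[OF p]] by simp
  show "push (eval_at_int S.D t p) \<in> carrier T.E"
    using S.D.eval_at_int_closed[OF p] by (simp add: push_lin_End)
next
  fix x assume "x \<in> carrier T"
  then have x: "x \<in> R" by simp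
  obtain N where N: "\<forall>i>N. p i = \<zero>\<^bsub>S.D\<^esub>" using p by (rule S.D.UP_bounded)
  have px: "p i x \<in> carrier S" for i using S.D.UP_coeff_closed[OF p] x by simp
  have s: "int_elem t [^] i \<in> R" for i :: nat
    using T.add.int_pow_closed[of \<one> t] by (simp add: T_int_elem[symmetric])
  have "push (eval_at_int S.D t p) x = \<beta> (\<Oplus>i\<in>{..N}. int_elem t [^] i \<otimes> p i x)"
    using S.eval_at_int_apply[OF p, of N x t] N x by (simp add: push_apply)
  also have "\<dots> = (\<Oplus>\<^bsub>T\<^esub>i\<in>{..N}. \<beta> (int_elem t [^] i \<otimes> p i x))"
    using px s by (intro beta_finsum) auto
  also have "\<dots> = (\<Oplus>\<^bsub>T\<^esub>i\<in>{..N}. int_elem t [^] i \<otimes> push (p i) x)"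
    using px s x by (simp add: beta_mult push_apply)
  also have "\<dots> = eval_at_int T.D t (\<lambda>i. push (p i)) x"
    using T.eval_at_int_apply[OF push_poly[OF p], of N x t] N x
    by (simp add: push_zero T_nat_pow T_int_elem)
  finally show "eval_at_int T.D t (\<lambda>i. push (p i)) x = push (eval_at_int S.D t p) x" by simp
qed

text \<open>
  With denominators cleared, the equation over \<open>S\<close> is carried by \<open>\<beta>\<close> to the equation over \<open>R\<close>: all
  factors other than the numerator of \<open>\<delta>(t)\<close> lie in \<open>R\<close> and are fixed by \<open>\<beta>\<close>. The bound \<open>m\<close> on the
  order of \<open>\<delta>(t)\<close> also serves for \<open>push (\<delta>(t))\<close>.
\<close>

lemma push_bs_pair:
  assumes A: "subcring A S" and "(p, b) \<in> bs_pairs A S f"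
  shows "((\<lambda>i. push (p i)), b) \<in> bs_pairs A T f"
proof -
  interpret A: cring "S\<lparr>carrier := A\<rparr>"
    using subcring_iff[of A] A subcringE(1)[OF A] by blast
  have p: "p \<in> carrier (UP S.D)" and b: "b \<in> carrier (UP (S\<lparr>carrier := A\<rparr>))"
    and eq: "\<And>t::int. loc_act A S f (eval_at_int S.D t p) (loc_frac S f f 0 [^]\<^bsub>loc_ring S f\<^esub> (t + 1)) =
      loc_frac S f (eval_at_int (S\<lparr>carrier := A\<rparr>) t b) 0 \<otimes>\<^bsub>loc_ring S f\<^esub>
        (loc_frac S f f 0 [^]\<^bsub>loc_ring S f\<^esub> t)"
    using assms(2) by (auto simp: bs_pairs_def)
  have "loc_act A T f (eval_at_int T.D t (\<lambda>i. push (p i))) (loc_frac T f f 0 [^]\<^bsub>loc_ring T f\<^esub> (t + 1)) =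
      loc_frac T f (eval_at_int (S\<lparr>carrier := A\<rparr>) t b) 0 \<otimes>\<^bsub>loc_ring T f\<^esub>
        (loc_frac T f f 0 [^]\<^bsub>loc_ring T f\<^esub> t)" for t :: int
  proof -
    let ?\<delta> = "eval_at_int S.D t p" and ?c = "eval_at_int (S\<lparr>carrier := A\<rparr>) t b"
    let ?v = "f [^] nat (t + 1)" and ?g = "f [^] nat (- (t + 1))"
    have c: "?c \<in> R" using A.eval_at_int_closed[OF b] by simp
    have "?\<delta> \<in> carrier S.D" by (rule S.D.eval_at_int_closed[OF p])
    then obtain m' where "?\<delta> \<in> S.diff_ops_lt m'" by (auto simp: S.diff_op_carrier)
    then obtain m where \<delta>: "?\<delta> \<in> S.diff_ops_lt (Suc m)"
      using S.diff_ops_lt_Suc by blast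
    then have E: "?\<delta> \<in> carrier S.E" by auto
    have N: "S.act_num (Suc m) ?\<delta> ?v ?g \<in> carrier S"
      by (rule S.act_num_lin_End_closed[OF E]) auto
    obtain k :: nat where "f [^] k \<otimes> (f [^] nat (- t) \<otimes> S.act_num (Suc m) ?\<delta> ?v ?g) =
        f [^] k \<otimes> (f [^] (nat (- (t + 1)) * Suc m) \<otimes> (?c \<otimes> f [^] nat t))"
      using S.bs_equation_iff[OF \<delta>, of ?c t] eq[of t] c by (auto simp del: S.act_num.simps)
    then have "\<beta> (f [^] k \<otimes> (f [^] nat (- t) \<otimes> S.act_num (Suc m) ?\<delta> ?v ?g)) =
        \<beta> (f [^] k \<otimes> (f [^] (nat (- (t + 1)) * Suc m) \<otimes> (?c \<otimes> f [^] nat t)))"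
      by (simp only:)
    then have "f [^] k \<otimes> (f [^] nat (- t) \<otimes> T.act_num (Suc m) (push ?\<delta>) ?v ?g) =
        f [^] k \<otimes> (f [^] (nat (- (t + 1)) * Suc m) \<otimes> (?c \<otimes> f [^] nat t))"
      using N c push_act_num[OF E, of ?v ?g "Suc m"]
      by (simp add: beta_mult del: S.act_num.simps T.act_num.simps mult_Suc_right)
    then show ?thesis
      using T.bs_equation_iff[OF push_diff_ops_lt[OF \<delta>], of ?c t] c
      by (auto simp: push_eval_at_int[OF p] T_nat_pow
          simp del: S.act_num.simps T.act_num.simps mult_Suc_right)
  qed
  then show ?thesis
    using push_poly[OF p] b by (simp add: bs_pairs_def)
qed

lemma bs_ideal_mono:
  assumes "subcring A S"
  shows "bs_ideal A S f \<subseteq> bs_ideal A T f"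
  using push_bs_pair[OF assms] unfolding bs_ideal_def by force

end

section \<open>Existence and divisibility\<close>

theorem theorem3p14:
  fixes S :: "('a, 'm) ring_scheme"
    and A R :: "'a set"
    and f :: 'a
    and \<beta> :: "'a \<Rightarrow> 'a"
  assumes "cring S"
    and "subcring R S"
    and "subcring A S"
    and "A \<subseteq> R"
    and "noetherian_ring S"
    and "noetherian_ring (S\<lparr>carrier := R\<rparr>)"
    and "noetherian_ring (S\<lparr>carrier := A\<rparr>)"
    and "is_splitting S R \<beta>"
    and "f \<in> R"
    and "bs_poly_exists A S f"
  shows "bs_poly_exists A (S\<lparr>carrier := R\<rparr>) f \<and>
    (\<forall>b\<^sub>R b\<^sub>S. is_bs_poly A (S\<lparr>carrier := R\<rparr>) f b\<^sub>R \<longrightarrow> is_bs_poly A S f b\<^sub>S \<longrightarrow>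
      b\<^sub>R divides\<^bsub>UP (S\<lparr>carrier := A\<rparr>)\<^esub> b\<^sub>S)"
proof -
  interpret split_subring S R A \<beta> f
    using assms by (intro split_subring.intro split_subring_axioms.intro)
  have mono: "bs_ideal A S f \<subseteq> bs_ideal A (S\<lparr>carrier := R\<rparr>) f"
    by (rule bs_ideal_mono[OF assms(3)])
  interpret A: cring "S\<lparr>carrier := A\<rparr>"
    using subcring_iff[of A] assms(3) subcringE(1)[OF assms(3)] by blast
  interpret A: UP_cring "S\<lparr>carrier := A\<rparr>" "UP (S\<lparr>carrier := A\<rparr>)"
    by unfold_locales simp
  let ?P = "UP (S\<lparr>carrier := A\<rparr>)"
  have "bs_poly_exists A (S\<lparr>carrier := R\<rparr>) f"
    using mono S.zero_in_bs_ideal[OF assms(3)] assms(10) by (auto simp: bs_poly_exists_def)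
  moreover have "b\<^sub>R divides\<^bsub>?P\<^esub> b\<^sub>S"
    if bR: "is_bs_poly A (S\<lparr>carrier := R\<rparr>) f b\<^sub>R" and bS: "is_bs_poly A S f b\<^sub>S" for b\<^sub>R b\<^sub>S
  proof -
    have car: "b\<^sub>R \<in> carrier ?P" "b\<^sub>S \<in> carrier ?P"
      using bR bS by (simp_all add: is_bs_poly_def)
    have "b\<^sub>S \<in> bs_ideal A S f"
      using bS A.P.cgenideal_self[OF car(2)] by (simp add: is_bs_poly_def)
    then have "b\<^sub>S \<in> PIdl\<^bsub>?P\<^esub> b\<^sub>R"
      using mono bR by (auto simp: is_bs_poly_def)
    then obtain x where "x \<in> carrier ?P" "b\<^sub>S = x \<otimes>\<^bsub>?P\<^esub> b\<^sub>R"
      by (auto simp: cgenideal_def)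
    then show ?thesis
      using car A.P.m_comm by (intro dividesI[of x]) auto
  qed
  ultimately show ?thesis by blast
qed

end
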